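(* Let $\epsilon>0$ be fixed. Then there is a constant $C>0$ such that for almost all $n\in\mathbb{N}$ the following holds: on every circulant graph of order $n$ the 2-dimensional Weisfeiler-Leman algorithm terminates (i.e. its coloring stabilizes) after at most $C\,\log(n)^{2+\epsilon}$ steps.
   Context: A property holds for almost all $n$ if the proportion of values $n\le N$ with this property tends to $1$ as $N\to\infty$. Graphs are directed graphs without loops (undirected graphs are the special case of a symmetric edge relation). For a finite group $H$ with neutral element $e$ and $S\subseteq H\setminus\{e\}$, the Cayley graph $\mathrm{Cay}(H,S)$ has vertex set $H$ and edge set $\{(h,sh): h\in H, s\in S\}$. A circulant graph of order $n$ is a Cayley graph over the cyclic group $\mathbb{Z}_n$. The 2-dimensional Weisfeiler-Leman algorithm (2-WL) on a graph $(V,E)$: the initial coloring of $V^2$ colors a pair $(v,w)$ according to which of the following hold: $v=w$, $(v,w)\in E$, $(w,v)\in E$ (so there are at most five colors). In one step, given the current coloring $c$ of $V^2$, each pair $(v_1,v_2)$ receives as new color the multiset $\{\{(c(v_1,v_2),c(v,v_2),c(v_1,v)) : v\in V\}\}$. This refines the partition of $V^2$ into color classes. The algorithm stabilizes (terminates) after $r$ steps, where $r$ is the least number such that the partition of $V^2$ after $r+1$ steps equals the partition after $r$ steps. *)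

theory Defs
  imports
    Complex_Main
    "HOL-Library.Multiset"
    "HOL-Algebra.Elementary_Groups"
    "Graph_Theory.Pair_Digraph"
begin

definition almost_all :: "(nat \<Rightarrow> bool) \<Rightarrow> bool" where
  "almost_all P \<longleftrightarrow> (\<lambda>N. real (card {n \<in> {1..N}. P n}) / real N) \<longlonglongrightarrow> 1"

definition cayley_graph :: "('a, 'b) monoid_scheme \<Rightarrow> 'a set \<Rightarrow> 'a pair_pre_digraph" where
  "cayley_graph H S =
     \<lparr> pverts = carrier H, parcs = {(h, s \<otimes>\<^bsub>H\<^esub> h) | h s. h \<in> carrier H \<and> s \<in> S} \<rparr>"

definition circulant_graph :: "nat \<Rightarrow> int pair_pre_digraph \<Rightarrow> bool" where
  "circulant_graph n G \<longleftrightarrow>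
     (\<exists>S \<subseteq> carrier (integer_mod_group n) - {\<one>\<^bsub>integer_mod_group n\<^esub>}.
        G = cayley_graph (integer_mod_group n) S)"

text \<open>
  An initial color records whether \<open>v = w\<close>, \<open>(v, w) \<in> E\<close> and \<open>(w, v) \<in> E\<close>; every later
  color is literally a multiset of triples of colors of the preceding step.
\<close>

datatype wl_color =
    Initial bool bool bool
  | Refined "(wl_color \<times> wl_color \<times> wl_color) multiset"

definition wl_initial :: "'a pair_pre_digraph \<Rightarrow> 'a \<times> 'a \<Rightarrow> wl_color" where
  "wl_initial G = (\<lambda>(v, w). Initial (v = w) ((v, w) \<in> parcs G) ((w, v) \<in> parcs G))"

definition wl_step :: "'a set \<Rightarrow> ('a \<times> 'a \<Rightarrow> wl_color) \<Rightarrow> 'a \<times> 'a \<Rightarrow> wl_color" where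
  "wl_step V c =
     (\<lambda>(v1, v2). Refined {# (c (v1, v2), c (v, v2), c (v1, v)). v \<in># mset_set V #})"

definition wl_coloring :: "'a pair_pre_digraph \<Rightarrow> nat \<Rightarrow> 'a \<times> 'a \<Rightarrow> wl_color" where
  "wl_coloring G r = (wl_step (pverts G) ^^ r) (wl_initial G)"

definition same_color :: "'a set \<Rightarrow> ('a \<times> 'a \<Rightarrow> 'c) \<Rightarrow> (('a \<times> 'a) \<times> ('a \<times> 'a)) set" where
  "same_color V c = {(p, q). p \<in> V \<times> V \<and> q \<in> V \<times> V \<and> c p = c q}"

definition wl_partition :: "'a pair_pre_digraph \<Rightarrow> nat \<Rightarrow> ('a \<times> 'a) set set" where
  "wl_partition G r = (pverts G \<times> pverts G) // same_color (pverts G) (wl_coloring G r)"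

definition wl_steps :: "'a pair_pre_digraph \<Rightarrow> nat" where
  "wl_steps G = (LEAST r. wl_partition G (Suc r) = wl_partition G r)"

text \<open>On a finite vertex set the partitions do become stable, so the \<open>LEAST\<close> above is attained.\<close>

lemma same_color_Suc_subset:
  assumes "finite (pverts G)"
  shows "same_color (pverts G) (wl_coloring G (Suc r)) \<subseteq> same_color (pverts G) (wl_coloring G r)"
proof clarify
  fix a b a' b'
  assume *: "((a, b), (a', b')) \<in> same_color (pverts G) (wl_coloring G (Suc r))"
  let ?c = "wl_coloring G r"
  have V: "a \<in> pverts G" "b \<in> pverts G" "a' \<in> pverts G" "b' \<in> pverts G"
    using * by (auto simp: same_color_def)
  have "image_mset (\<lambda>v. (?c (a, b), ?c (v, b), ?c (a, v))) (mset_set (pverts G)) =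
        image_mset (\<lambda>v. (?c (a', b'), ?c (v, b'), ?c (a', v))) (mset_set (pverts G))"
    using * by (simp add: same_color_def wl_coloring_def wl_step_def)
  from arg_cong[where f = set_mset, OF this]
  have "(\<lambda>v. (?c (a, b), ?c (v, b), ?c (a, v))) ` pverts G =
             (\<lambda>v. (?c (a', b'), ?c (v, b'), ?c (a', v))) ` pverts G"
    by (simp only: set_image_mset finite_set_mset_mset_set[OF assms])
  then have "?c (a, b) = ?c (a', b')"
    using V(1) by blast
  then show "((a, b), (a', b')) \<in> same_color (pverts G) ?c"
    using V by (simp add: same_color_def)
qed

lemma wl_steps_stable:
  assumes "finite (pverts G)"
  shows "wl_partition G (Suc (wl_steps G)) = wl_partition G (wl_steps G)"
proof -
  let ?R = "\<lambda>r. same_color (pverts G) (wl_coloring G r)"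
  have fin: "finite (?R r)" for r
    by (rule finite_subset[of _ "(pverts G \<times> pverts G) \<times> (pverts G \<times> pverts G)"])
       (auto simp: same_color_def assms)
  have "\<exists>r. ?R (Suc r) = ?R r"
  proof (rule ccontr)
    assume "\<nexists>r. ?R (Suc r) = ?R r"
    then have less: "card (?R (Suc r)) < card (?R r)" for r
      by (intro psubset_card_mono fin psubsetI same_color_Suc_subset assms) simp
    have "card (?R r) + r \<le> card (?R 0)" for r
    proof (induction r)
      case (Suc r)
      then show ?case using less[of r] by linarith
    qed simp
    from this[of "Suc (card (?R 0))"] show False by simp
  qed
  then obtain r where "?R (Suc r) = ?R r" ..
  then have "wl_partition G (Suc r) = wl_partition G r"
    by (simp only: wl_partition_def)
  then show ?thesis
    unfolding wl_steps_def by (rule LeastI)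
qed

lemma circulant_graph_digraph:
  assumes "circulant_graph n G" and "n > 0"
  shows "finite (pverts G)" and "card (pverts G) = n" and "pair_loopfree_digraph G"
proof -
  obtain S where S: "S \<subseteq> carrier (integer_mod_group n) - {\<one>\<^bsub>integer_mod_group n\<^esub>}"
    and G: "G = cayley_graph (integer_mod_group n) S"
    using assms(1) by (auto simp: circulant_graph_def)
  show "finite (pverts G)" "card (pverts G) = n"
    using \<open>n > 0\<close> by (auto simp: G cayley_graph_def carrier_integer_mod_group)
  interpret Z: group "integer_mod_group n" by simp
  show "pair_loopfree_digraph G"
  proof
    fix e assume "e \<in> parcs G"
    then obtain h s where e: "e = (h, s \<otimes>\<^bsub>integer_mod_group n\<^esub> h)"
      and hs: "h \<in> carrier (integer_mod_group n)" "s \<in> S"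
      by (auto simp: G cayley_graph_def)
    have s: "s \<in> carrier (integer_mod_group n)" "s \<noteq> \<one>\<^bsub>integer_mod_group n\<^esub>"
      using S hs by auto
    have "s \<otimes>\<^bsub>integer_mod_group n\<^esub> h \<in> carrier (integer_mod_group n)"
      by (rule Z.m_closed[OF s(1) hs(1)])
    then show "fst e \<in> pverts G" "snd e \<in> pverts G"
      unfolding e G cayley_graph_def fst_conv snd_conv pair_pre_digraph.simps
      using hs(1) by (simp_all only:)
    show "fst e \<noteq> snd e"
      unfolding e fst_conv snd_conv
      using Z.l_cancel_one'[OF hs(1) s(1)] Z.r_cancel_one'[OF hs(1) s(1)] s(2) by blast
  qed
qed

end

theory Submission
  imports
    Defs
    "HOL-Number_Theory.Residues"
    "HOL-Computational_Algebra.Polynomial"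
    "HOL-Real_Asymp.Real_Asymp"
begin

text \<open>
The coloring of a circulant graph is invariant under translations, so after \<open>r\<close> steps it is an
equivalence relation \<open>P r\<close> on \<open>\<int>/n\<close>, and one step of the algorithm makes the cyclic convolution
of any two functions that are constant on the classes of \<open>P r\<close> constant on those of \<open>P (r + 1)\<close>.

The first idea is Schur's theorem on multipliers. If \<open>X\<close> is a class of \<open>P r\<close> and \<open>p\<close> a prime not
dividing \<open>n\<close>, then the \<open>p\<close>-th power of the element \<open>X\<close> of the group ring is congruent modulo \<open>p\<close> to
the element \<open>p X\<close>. Repeated squaring computes that power in about \<open>log p\<close> steps, so \<open>p X\<close> is a union
of later classes. Multiplying such primes together, all sets \<open>m X\<close> with \<open>m\<close> a unit modulo \<open>n\<close> are
unions of classes after \<open>l \<le> 2 log n\<close> further steps (lemma \<open>P_imp_unit_core\<close>). Up to a delay of \<open>l\<close>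
steps the relations \<open>P r\<close> are thus invariant under multiplication by units.

The second idea is that a strictly decreasing chain of such unit-invariant equivalence relations is
short. The units have one orbit for each divisor \<open>g\<close> of \<open>n\<close>. An invariant relation is described by
the subgroup of units \<open>u\<close> for which \<open>u g\<close> is related to \<open>g\<close>, for each \<open>g\<close>, together with the
information which orbits are linked. In a decreasing chain every subgroup can shrink at most
\<open>\<Omega>(\<phi>(n))\<close> times, and links can be broken at most \<open>d(n)\<close> times, where \<open>d\<close> counts divisors and \<open>\<Omega>\<close>
counts prime factors with multiplicity. Hence the algorithm needs at most about
\<open>d(n) (\<Omega>(\<phi>(n)) + 1) \<cdot> 2 log n\<close> steps (lemma \<open>circulant_graph_wl_steps_le\<close>).

It remains to bound these arithmetic functions for almost all \<open>n\<close>. The mean of \<open>d\<close> up to \<open>N\<close> is at most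
\<open>1 + log N\<close>, so by Markov's inequality \<open>d(n) \<le> (log N)\<^bsup>1+\<delta>\<^esup>\<close> outside a set of density zero
(lemma \<open>card_many_divisors_le\<close>). For \<open>\<Omega>(\<phi>(n))\<close>, which is governed by the prime factors of \<open>n\<close> and of
the numbers \<open>p - 1\<close> with \<open>p\<close> a prime factor of \<open>n\<close>, a crude union bound suffices. The integers \<open>m \<le> N\<close> with at least \<open>k\<close>
distinct prime factors or divisible by a \<open>k\<close>-th prime power have reciprocal sum
\<open>O((log N)\<^sup>2 / 2\<^sup>k)\<close>, so even when \<open>p\<close> ranges over all integers such that \<open>p - 1\<close> is of this kind, few
\<open>n\<close> have a divisor \<open>p\<close> (lemma \<open>card_many_factors_le\<close>). With \<open>k\<close> a small power of \<open>log N\<close> this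
leaves \<open>\<Omega>(\<phi>(n)) \<le> 16 (log N)\<^sup>\<delta>\<close> for almost all \<open>n\<close>.
\<close>

section \<open>Folding polynomials modulo a cyclic group\<close>

text \<open>
The coefficient at \<open>x\<close> of the image of \<open>A\<close> in the group ring \<open>\<int>[\<int>/n] = \<int>[X]/(X\<^sup>n - 1)\<close>. Representing
group ring elements by polynomials gives access to their powers without a type depending on \<open>n\<close>.
\<close>

definition fold_poly :: "nat \<Rightarrow> int poly \<Rightarrow> int \<Rightarrow> int" where
  "fold_poly n A x = (\<Sum>i\<le>Polynomial.degree A. if [int i = x] (mod int n) then coeff A i else 0)"

lemma fold_poly_extend:
  assumes "Polynomial.degree A \<le> D"
  shows "fold_poly n A x = (\<Sum>i\<le>D. if [int i = x] (mod int n) then coeff A i else 0)"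
  unfolding fold_poly_def
  by (rule sum.mono_neutral_left) (use assms in \<open>auto simp: coeff_eq_0\<close>)

lemma fold_poly_0 [simp]: "fold_poly n 0 x = 0"
  unfolding fold_poly_def by (rule sum.neutral) auto

lemma fold_poly_add: "fold_poly n (A + B) x = fold_poly n A x + fold_poly n B x"
proof -
  let ?D = "max (Polynomial.degree A) (Polynomial.degree B)"
  have "Polynomial.degree (A + B) \<le> ?D" by (rule degree_add_le_max)
  then show ?thesis
    by (simp add: fold_poly_extend[of _ ?D] sum.distrib[symmetric]) (rule sum.cong, auto)
qed

lemma fold_poly_smult: "fold_poly n (smult c A) x = c * fold_poly n A x"
  unfolding fold_poly_extend[OF degree_smult_le] fold_poly_def[of n A] sum_distrib_left
  by (rule sum.cong) auto

lemma fold_poly_sum: "fold_poly n (\<Sum>i\<in>I. A i) x = (\<Sum>i\<in>I. fold_poly n (A i) x)"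
  by (induction I rule: infinite_finite_induct) (simp_all add: fold_poly_add)

lemma fold_poly_monom:
  "fold_poly n (monom c k) x = (if [int k = x] (mod int n) then c else 0)"
proof -
  have "fold_poly n (monom c k) x
      = (\<Sum>i\<le>k. if i = k then (if [int k = x] (mod int n) then c else 0) else 0)"
    unfolding fold_poly_extend[OF degree_monom_le] by (intro sum.cong) auto
  then show ?thesis by simp
qed

lemma fold_poly_pCons:
  "fold_poly n (pCons c A) x = (if [0 = x] (mod int n) then c else 0) + fold_poly n A (x - 1)"
proof -
  have shift: "[1 + int i = x] (mod int n) \<longleftrightarrow> [int i = x - 1] (mod int n)" for i
    by (metis add.commute cong_add_rcancel diff_add_cancel)
  show ?thesis
    unfolding fold_poly_extend[OF degree_pCons_le] fold_poly_def[of n A] sum.atMost_Suc_shift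
    by (auto simp: shift intro!: sum.cong)
qed

lemma fold_poly_cong:
  "[x = y] (mod int n) \<Longrightarrow> fold_poly n A x = fold_poly n A y"
  unfolding fold_poly_def by (intro sum.cong refl) (auto dest: cong_trans cong_sym)

definition cyclic_conv :: "nat \<Rightarrow> (int \<Rightarrow> int) \<Rightarrow> (int \<Rightarrow> int) \<Rightarrow> int \<Rightarrow> int" where
  "cyclic_conv n a b x = (\<Sum>t\<in>{0..<int n}. a (x - t) * b t)"

text \<open>
Both sides are additive in \<open>A\<close>, and multiplying \<open>A\<close> by \<open>X\<close> shifts both by one, so induction over the
coefficients of \<open>A\<close> suffices.
\<close>

lemma fold_poly_mult:
  assumes "n > 0"
  shows "fold_poly n (A * B) x = cyclic_conv n (fold_poly n A) (fold_poly n B) x"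
  unfolding cyclic_conv_def
proof (induction A arbitrary: x)
  case 0
  show ?case by simp
next
  case (pCons c A)
  let ?T = "{0..<int n}"
  have zero: "[0 = x - t] (mod int n) \<longleftrightarrow> t = x mod int n" if "t \<in> ?T" for t
    using that by (auto simp: cong_iff_dvd_diff mod_eq_dvd_iff dvd_diff_commute
        intro!: mod_pos_pos_trivial[symmetric] simp flip: mod_eq_dvd_iff)
  have "(\<Sum>t\<in>?T. fold_poly n (pCons c A) (x - t) * fold_poly n B t)
      = (\<Sum>t\<in>?T. (if t = x mod int n then c * fold_poly n B t else 0))
        + (\<Sum>t\<in>?T. fold_poly n A (x - 1 - t) * fold_poly n B t)"
    unfolding sum.distrib[symmetric]
    by (intro sum.cong refl) (auto simp: fold_poly_pCons zero algebra_simps)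
  also have "(\<Sum>t\<in>?T. (if t = x mod int n then c * fold_poly n B t else 0)) = c * fold_poly n B x"
    using \<open>n > 0\<close> fold_poly_cong[of "x mod int n" x n B] by (simp add: sum.delta)
  also have "(\<Sum>t\<in>?T. fold_poly n A (x - 1 - t) * fold_poly n B t) = fold_poly n (A * B) (x - 1)"
    by (rule pCons.IH[symmetric])
  also have "c * fold_poly n B x + fold_poly n (A * B) (x - 1) = fold_poly n (pCons c A * B) x"
    by (simp add: fold_poly_add fold_poly_smult fold_poly_pCons)
  finally show ?case by simp
qed

text \<open>
A version of the Frobenius identity for rings of arbitrary characteristic, as a divisibility: it is
applied to integer polynomials with the prime \<open>p\<close> varying.
\<close>

lemma freshmans_dream_dvd:
  fixes x y :: "'a :: comm_ring_1"
  assumes "Factorial_Ring.prime p"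
  shows "of_nat p dvd (x + y) ^ p - (x ^ p + y ^ p)"
proof -
  have p: "p > 0" using assms by (simp add: prime_gt_0_nat)
  let ?t = "\<lambda>k. of_nat (p choose k) * x ^ k * y ^ (p - k)"
  have "{..p} = insert 0 (insert p {1..<p})" using p by auto
  then have "(x + y) ^ p = x ^ p + y ^ p + (\<Sum>k\<in>{1..<p}. ?t k)"
    unfolding binomial_ring using p by (simp add: algebra_simps)
  then have "(x + y) ^ p - (x ^ p + y ^ p) = (\<Sum>k\<in>{1..<p}. ?t k)"
    by simp
  moreover have "of_nat p dvd (of_nat (p choose k) :: 'a)" if "k \<in> {1..<p}" for k
    using dvd_choose_prime[of k p] that assms by auto
  ultimately show ?thesis
    by (auto intro!: dvd_sum dvd_mult2)
qed

lemma freshmans_dream_sum_dvd: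
  fixes f :: "'b \<Rightarrow> 'a :: comm_ring_1"
  assumes "Factorial_Ring.prime p"
  shows "of_nat p dvd (\<Sum>i\<in>I. f i) ^ p - (\<Sum>i\<in>I. f i ^ p)"
proof (induction I rule: infinite_finite_induct)
  case (insert i I)
  have "of_nat p dvd ((f i + sum f I) ^ p - (f i ^ p + sum f I ^ p))
      + (sum f I ^ p - (\<Sum>i\<in>I. f i ^ p))"
    by (intro dvd_add freshmans_dream_dvd assms insert.IH)
  then show ?case
    using insert.hyps by (simp add: algebra_simps)
qed (use prime_gt_0_nat[OF assms] in \<open>simp_all add: power_0_left\<close>)

section \<open>Multipliers of a refining sequence on a cyclic group\<close>

text \<open>
The abstract situation of the algorithm on a cyclic group, with \<open>P r\<close> the relation of having the
same color after \<open>r\<close> steps. The last assumption is all that is used of a refinement step: the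
functions that are constant on the classes of \<open>P (Suc r)\<close> contain all convolutions of functions
constant on the classes of \<open>P r\<close>.
\<close>

locale cyclic_refinement =
  fixes n :: nat and P :: "nat \<Rightarrow> int \<Rightarrow> int \<Rightarrow> bool"
  assumes n_gt_1: "1 < n"
    and equivp_P: "equivp (P r)"
    and cong_imp_P: "[x = y] (mod int n) \<Longrightarrow> P r x y"
    and P_SucD: "P (Suc r) x y \<Longrightarrow> P r x y"
    and conv_invariant:
      "(\<And>u v. P r u v \<Longrightarrow> a u = a v) \<Longrightarrow> (\<And>u v. P r u v \<Longrightarrow> b u = b v) \<Longrightarrow>
        P (Suc r) x y \<Longrightarrow> cyclic_conv n a b x = cyclic_conv n a b y"
begin

lemma P_refl: "P r x x" and P_sym: "P r x y \<Longrightarrow> P r y x"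
  and P_trans: "P r x y \<Longrightarrow> P r y z \<Longrightarrow> P r x z"
  using equivp_P[of r] by (auto elim: equivpE dest: reflpD sympD transpD)

lemma P_addD: "P (r + j) x y \<Longrightarrow> P r x y"
  by (induction j) (auto dest: P_SucD)

lemma P_antimono: "r \<le> s \<Longrightarrow> P s x y \<Longrightarrow> P r x y"
  using P_addD[of r "s - r"] by simp

text \<open>
A \<open>k\<close>-th power is the product of two powers with exponents about \<open>k / 2\<close>, so each step doubles the
exponents that are available. This is where the number of steps becomes logarithmic.
\<close>

lemma power_invariant:
  assumes "\<And>u v. P r u v \<Longrightarrow> fold_poly n A u = fold_poly n A v"
    and "1 \<le> k" "k \<le> 2 ^ j" "P (r + j) x y"
  shows "fold_poly n (A ^ k) x = fold_poly n (A ^ k) y"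
  using assms(2-4)
proof (induction j arbitrary: k x y)
  case 0
  then have "k = 1" by simp
  then show ?case using 0 assms(1) by simp
next
  case (Suc j)
  show ?case
  proof (cases "k = 1")
    case True
    have "P r x y" using Suc.prems(3) by (rule P_addD)
    with True show ?thesis using assms(1) by simp
  next
    case False
    define l where "l = k div 2"
    have l: "1 \<le> l" "l \<le> 2 ^ j" "1 \<le> k - l" "k - l \<le> 2 ^ j" "k = l + (k - l)"
      using False Suc.prems(1,2) by (auto simp: l_def)
    have "P (Suc (r + j)) x y" using Suc.prems(3) by simp
    from conv_invariant[OF Suc.IH[OF l(1,2)] Suc.IH[OF l(3,4)] this]
    have "fold_poly n (A ^ l * A ^ (k - l)) x = fold_poly n (A ^ l * A ^ (k - l)) y"
      using n_gt_1 by (simp add: fold_poly_mult)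
    then show ?thesis using l(5) by (metis power_add)
  qed
qed

text \<open>
Let \<open>A\<close> be the group ring element formed by the class of \<open>z\<close>. Modulo \<open>p\<close>, the coefficient of \<open>A ^ p\<close> at
\<open>p x\<close> is the indicator of the class of \<open>z\<close> at \<open>x\<close>, because \<open>p\<close> is invertible modulo \<open>n\<close>. After \<open>j\<close> steps
the coefficients of \<open>A ^ p\<close> are determined by the color, hence so is membership of \<open>x\<close> in that class.
\<close>

lemma prime_multiplier:
  assumes p: "Factorial_Ring.prime p" "\<not> p dvd n" "p \<le> 2 ^ j"
    and rel: "P (r + j) (int p * z) (int p * z')"
  shows "P r z z'"
proof -
  let ?T = "{0..<n}"
  define a where "a t = (if P r z t then 1 else 0 :: int)" for t
  define A where "A = (\<Sum>t\<in>?T. monom (a (int t)) t)"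
  have a_cong: "a u = a v" if "P r u v" for u v
    using that unfolding a_def by (meson P_sym P_trans)
  have residue: "(\<Sum>t\<in>?T. if [int t = x] (mod int n) then f (int t) else 0) = f (x mod int n)"
    for x and f :: "int \<Rightarrow> int"
  proof -
    define t0 where "t0 = nat (x mod int n)"
    have t0: "int t0 = x mod int n" "t0 < n"
      using n_gt_1 by (auto simp: t0_def nat_less_iff)
    have "[int t = x] (mod int n) \<longleftrightarrow> t = t0" if "t \<in> ?T" for t
    proof -
      have "[int t = x] (mod int n) \<longleftrightarrow> int t = int t0"
        using that unfolding Cong.cong_def t0(1) by simp
      then show ?thesis by simp
    qed
    then have "(\<Sum>t\<in>?T. if [int t = x] (mod int n) then f (int t) else 0)
        = (\<Sum>t\<in>?T. if t = t0 then f (int t) else 0)"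
      by (intro sum.cong) auto
    then show ?thesis using t0 by simp
  qed
  have a_mod: "a (x mod int n) = a x" for x
    by (rule a_cong, rule cong_imp_P) simp
  have fold_A: "fold_poly n A x = a x" for x
    by (simp add: A_def fold_poly_sum fold_poly_monom residue a_mod)
  have p0: "p > 0" using p(1) by (simp add: prime_gt_0_nat)
  have cop: "coprime (int p) (int n)"
    using p(1,2) by (simp add: prime_imp_coprime)
  \<comment> \<open>the Frobenius map on the group ring, read off at the position \<open>p x\<close>\<close>
  have frob: "[fold_poly n (A ^ p) (int p * x) = a x] (mod int p)" for x
  proof -
    obtain B where B: "A ^ p - (\<Sum>t\<in>?T. monom (a (int t)) t ^ p) = of_nat p * B"
      using freshmans_dream_sum_dvd[OF p(1), of "\<lambda>t. monom (a (int t)) t" ?T]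
      unfolding A_def by blast
    have "A ^ p = (\<Sum>t\<in>?T. monom (a (int t)) t ^ p) + smult (int p) B"
      using B by (simp add: of_nat_poly algebra_simps)
    also have "(\<Sum>t\<in>?T. monom (a (int t)) t ^ p) = (\<Sum>t\<in>?T. monom (a (int t)) (p * t))"
      using p0 by (intro sum.cong refl) (auto simp: monom_power a_def mult.commute)
    finally have Ap: "A ^ p = (\<Sum>t\<in>?T. monom (a (int t)) (p * t)) + smult (int p) B" .
    have "fold_poly n (\<Sum>t\<in>?T. monom (a (int t)) (p * t)) (int p * x)
        = (\<Sum>t\<in>?T. if [int t = x] (mod int n) then a (int t) else 0)"
      using cong_mult_lcancel[OF cop] by (simp add: fold_poly_sum fold_poly_monom)
    also have "\<dots> = a x" by (simp add: residue a_mod)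
    finally show ?thesis
      by (simp add: Ap fold_poly_add fold_poly_smult Cong.cong_def)
  qed
  have "fold_poly n (A ^ p) (int p * z) = fold_poly n (A ^ p) (int p * z')"
    by (rule power_invariant[where r = r and j = j]) (use a_cong fold_A p p0 rel in auto)
  then have "[a z = a z'] (mod int p)"
    using frob[of z] frob[of z'] by (metis cong_sym cong_trans)
  moreover have "a z = 1" by (simp add: a_def P_refl)
  moreover have "\<not> [1 = 0] (mod int p)"
    using prime_gt_1_nat[OF p(1)] by (simp add: Cong.cong_def)
  ultimately have "a z' \<noteq> 0" by auto
  then show ?thesis by (auto simp: a_def split: if_splits)
qed

text \<open>
The multiplier \<open>m\<close> is treated one prime factor at a time. Rounding a prime \<open>p\<close> up to a power of two
at most squares it, so the delays add up to at most \<open>2 log\<^sub>2 m\<close>.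
\<close>

lemma coprime_multiplier:
  assumes "m > 0" "coprime m n"
  shows "\<exists>j. 2 ^ j \<le> m\<^sup>2 \<and> (\<forall>r z z'. P (r + j) (int m * z) (int m * z') \<longrightarrow> P r z z')"
  using assms
proof (induction m rule: less_induct)
  case (less m)
  show ?case
  proof (cases "m = 1")
    case True
    then show ?thesis by (intro exI[of _ 0]) simp
  next
    case False
    obtain p where p: "Factorial_Ring.prime p" "p dvd m"
      using False prime_factor_nat by blast
    obtain l where l: "m = p * l" using p(2) by blast
    have p1: "p > 1" by (rule prime_gt_1_nat[OF p(1)])
    have "l > 0" "l < m" using less.prems(1) p1 unfolding l by auto
    moreover have cop: "coprime p n" "coprime l n" using less.prems(2) unfolding l by auto
    ultimately obtain j where j: "2 ^ j \<le> l\<^sup>2"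
        "\<And>r z z'. P (r + j) (int l * z) (int l * z') \<Longrightarrow> P r z z'"
      using less.IH[of l] by blast
    obtain i where i: "p \<le> 2 ^ i" "2 ^ i \<le> p\<^sup>2"
    proof -
      define i where "i = (LEAST i. p \<le> 2 ^ i)"
      have ex: "p \<le> 2 ^ p" by (simp add: less_imp_le)
      have i: "p \<le> 2 ^ i" unfolding i_def by (rule LeastI[of _ p]) (rule ex)
      then have "i \<noteq> 0" using p1 by (cases i) auto
      then have "\<not> p \<le> 2 ^ (i - 1)" unfolding i_def by (intro not_less_Least) simp
      then have "2 ^ i \<le> 2 * p" using \<open>i \<noteq> 0\<close> by (cases i) auto
      also have "2 * p \<le> p\<^sup>2" using p1 by (simp add: power2_eq_square)
      finally show ?thesis using i that by blast
    qed
    have ndvd: "\<not> p dvd n"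
      using cop(1) p1 by (metis coprime_common_divisor_nat dvd_refl less_irrefl)
    have step: "P r z z'" if "P (r + (i + j)) (int m * z) (int m * z')" for r z z'
    proof -
      have "P (r + j + i) (int p * (int l * z)) (int p * (int l * z'))"
        using that by (simp add: l algebra_simps)
      from prime_multiplier[OF p(1) ndvd i(1) this] show ?thesis by (rule j(2))
    qed
    have "2 ^ (i + j) \<le> p\<^sup>2 * l\<^sup>2"
      unfolding power_add by (intro mult_mono i j) auto
    then show ?thesis
      using step by (intro exI[of _ "i + j"]) (auto simp: l power_mult_distrib)
  qed
qed

text \<open>
The coarsest relation finer than \<open>P r\<close> that is invariant under multiplication by units.
\<close>

definition unit_core :: "nat \<Rightarrow> int \<Rightarrow> int \<Rightarrow> bool" where
  "unit_core r x y \<longleftrightarrow> (\<forall>u. coprime u (int n) \<longrightarrow> P r (u * x) (u * y))"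

text \<open>
The residue class of the unit \<open>u\<close> is undone by a multiplier \<open>m < n\<close>, for which \<open>l\<close> steps are enough.
Together with \<open>unit_core_imp_P\<close> this sandwiches \<open>unit_core r\<close> between \<open>P (r + l)\<close> and \<open>P r\<close>.
\<close>

lemma P_imp_unit_core:
  assumes "n\<^sup>2 < 2 ^ Suc l" "P (r + l) x y"
  shows "unit_core r x y"
  unfolding unit_core_def
proof (intro allI impI)
  fix u assume u: "coprime u (int n)"
  \<comment> \<open>\<open>m\<close> is the inverse of \<open>u\<close> modulo \<open>n\<close>, reduced to a natural number below \<open>n\<close>\<close>
  obtain v where v: "[u * v = 1] (mod int n)" using cong_solve_coprime_int[OF u] by blast
  define m where "m = nat (v mod int n)"
  have m_int: "int m = v mod int n" using n_gt_1 by (simp add: m_def)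
  have m: "[int m * u = 1] (mod int n)"
    using v unfolding m_int Cong.cong_def mod_mult_left_eq by (simp only: mult.commute)
  then have "coprime (int m) (int n)"
    using coprime_iff_invertible_int by blast
  then have cop: "coprime m n" by simp
  have "m \<noteq> 0" using cop n_gt_1 by (auto intro: Nat.gr0I)
  moreover have "m < n" using m_int n_gt_1
    by (metis of_nat_less_iff pos_mod_bound of_nat_0_less_iff less_trans zero_less_one)
  ultimately obtain j where j: "2 ^ j \<le> m\<^sup>2"
      "\<And>r z z'. P (r + j) (int m * z) (int m * z') \<Longrightarrow> P r z z'"
    using coprime_multiplier[of m] cop by blast
  have "m\<^sup>2 \<le> n\<^sup>2" using \<open>m < n\<close> by (intro power_mono) auto
  then have "(2::nat) ^ j < 2 ^ Suc l" using assms(1) j(1) by linarith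
  then have "j \<le> l" by (simp add: power_strict_increasing_iff less_Suc_eq_le del: power_Suc)
  then have P: "P (r + j) x y"
    using P_antimono[of "r + j" "r + l"] assms(2) by simp
  have eq: "P s (int m * (u * z)) z" for s z
    using cong_mult[OF m cong_refl[of z]] by (intro cong_imp_P) (simp add: mult.assoc)
  show "P r (u * x) (u * y)"
    by (rule j(2)) (meson P P_sym P_trans eq)
qed

lemma unit_core_imp_P: "unit_core r x y \<Longrightarrow> P r x y"
  unfolding unit_core_def by (drule spec[of _ 1]) simp

lemma equivp_unit_core: "equivp (unit_core r)"
  unfolding unit_core_def by (rule equivpI) (auto simp: reflp_def symp_def transp_def intro: P_refl P_sym P_trans)

lemma cong_imp_unit_core: "[x = y] (mod int n) \<Longrightarrow> unit_core r x y"
  unfolding unit_core_def by (auto intro!: cong_imp_P cong_mult)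

lemma unit_core_mult: "unit_core r x y \<Longrightarrow> coprime u (int n) \<Longrightarrow> unit_core r (u * x) (u * y)"
  unfolding unit_core_def by (auto simp flip: mult.assoc)

lemma unit_core_antimono: "r \<le> s \<Longrightarrow> unit_core s x y \<Longrightarrow> unit_core r x y"
  unfolding unit_core_def by (intro allI impI) (rule P_antimono[of r s]; simp)

end

section \<open>Chains of unit-invariant equivalence relations\<close>

definition bigomega :: "nat \<Rightarrow> nat" where
  "bigomega m = size (prime_factorization m)"

definition divisor_count :: "nat \<Rightarrow> nat" where
  "divisor_count n = card {g. g dvd n}"

lemma bigomega_mono: "a dvd b \<Longrightarrow> b \<noteq> 0 \<Longrightarrow> bigomega a \<le> bigomega b"
  unfolding bigomega_def
  by (intro size_mset_mono) (auto simp: prime_factorization_subset_iff_dvd dvd_0_left_iff)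

text \<open>
This makes \<open>bigomega\<close> of the order a strictly monotone measure on chains of subgroups.
\<close>

lemma bigomega_dvd_eq:
  assumes "a dvd b" "b \<noteq> 0" "bigomega b \<le> bigomega a"
  shows "a = b"
proof -
  have "prime_factorization a \<subseteq># prime_factorization b"
    using assms(1,2) by (subst prime_factorization_subset_iff_dvd) auto
  then have "prime_factorization a = prime_factorization b"
    using assms(3) mset_subset_size unfolding bigomega_def by (force simp: subset_mset.le_less)
  moreover have "a > 0" "b > 0" using assms(1,2) by (auto intro: Nat.gr0I)
  ultimately show ?thesis
    by (metis prod_mset_prime_factorization_nat)
qed

definition unit_invariant :: "nat \<Rightarrow> (int \<Rightarrow> int \<Rightarrow> bool) \<Rightarrow> bool" where
  "unit_invariant n R \<longleftrightarrow> equivp R \<and> (\<forall>x y. [x = y] (mod int n) \<longrightarrow> R x y) \<and>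
     (\<forall>u x y. coprime u (int n) \<longrightarrow> R x y \<longrightarrow> R (u * x) (u * y))"

lemma unit_invariantD:
  assumes "unit_invariant n R"
  shows "R x x" "R x y \<Longrightarrow> R y x" "R x y \<Longrightarrow> R y z \<Longrightarrow> R x z"
    "[x = y] (mod int n) \<Longrightarrow> R x y" "coprime u (int n) \<Longrightarrow> R x y \<Longrightarrow> R (u * x) (u * y)"
proof -
  have "equivp R" using assms by (simp add: unit_invariant_def)
  then show "R x x" "R x y \<Longrightarrow> R y x" "R x y \<Longrightarrow> R y z \<Longrightarrow> R x z"
    by (auto elim: equivpE dest: reflpD sympD transpD)
  show "[x = y] (mod int n) \<Longrightarrow> R x y" "coprime u (int n) \<Longrightarrow> R x y \<Longrightarrow> R (u * x) (u * y)"
    using assms by (simp_all add: unit_invariant_def)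
qed

text \<open>
The setwise stabilizer, in the group of units, of the class of \<open>x\<close> restricted to the orbit of \<open>x\<close>.
Since the group is abelian, it depends only on the orbit.
\<close>

definition unit_stab :: "nat \<Rightarrow> (int \<Rightarrow> int \<Rightarrow> bool) \<Rightarrow> int \<Rightarrow> int set" where
  "unit_stab n R x = {u. 0 < u \<and> u < int n \<and> coprime u (int n) \<and> R (u * x) x}"

lemma unit_stab_iff:
  assumes "n > 1" "unit_invariant n R" "coprime u (int n)"
  shows "R (u * x) x \<longleftrightarrow> u mod int n \<in> unit_stab n R x"
proof -
  have cop: "coprime (u mod int n) (int n)" using assms(1,3) by simp
  have "u mod int n \<noteq> 0" using cop assms(1) by auto
  then have "0 < u mod int n" using assms(1)
    by (simp add: order_less_le)
  moreover have "R (u mod int n * x) (u * x)"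
    by (intro unit_invariantD(4)[OF assms(2)] cong_mult) auto
  ultimately have "R (u * x) x \<longleftrightarrow> R (u mod int n * x) x"
    using unit_invariantD(2,3)[OF assms(2)] by blast
  then show ?thesis
    using cop assms(1) \<open>0 < u mod int n\<close> by (simp add: unit_stab_def)
qed

lemma subgroup_unit_stab:
  assumes n: "n > 1" and R: "unit_invariant n R"
  shows "subgroup (unit_stab n R x) (units_of (residue_ring (int n)))"
proof -
  interpret residues "int n" "residue_ring (int n)"
    by unfold_locales (use n in auto)
  interpret U: group "units_of (residue_ring (int n))" by (rule units_group)
  note inv = unit_invariantD[OF R]
  show ?thesis
  proof (rule U.subgroupI)
    show "unit_stab n R x \<subseteq> carrier (units_of (residue_ring (int n)))"
      by (auto simp: unit_stab_def units_of_carrier res_units_eq)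
    show "unit_stab n R x \<noteq> {}"
      using n inv(1) by (auto simp: unit_stab_def intro!: exI[of _ 1])
  next
    fix u v assume u: "u \<in> unit_stab n R x" and v: "v \<in> unit_stab n R x"
    then have cop: "coprime (u * v) (int n)" by (simp add: unit_stab_def)
    have "R (u * (v * x)) (u * x)" using u v by (intro inv(5)) (auto simp: unit_stab_def)
    then have "R (u * v * x) x"
      using u inv(3) unfolding unit_stab_def mult.assoc by blast
    then show "u \<otimes>\<^bsub>units_of (residue_ring (int n))\<^esub> v \<in> unit_stab n R x"
      using unit_stab_iff[OF n R cop] by (simp add: units_of_mult res_mult_eq)
  next
    fix u assume u: "u \<in> unit_stab n R x"
    then have u': "u \<in> carrier (units_of (residue_ring (int n)))"
      by (auto simp: unit_stab_def units_of_carrier res_units_eq)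
    define v where "v = inv\<^bsub>units_of (residue_ring (int n))\<^esub> u"
    have v: "v \<in> carrier (units_of (residue_ring (int n)))"
      unfolding v_def using u' by (rule U.inv_closed)
    then have v': "0 < v" "v < int n" "coprime v (int n)"
      by (auto simp: units_of_carrier res_units_eq)
    have "v \<otimes>\<^bsub>units_of (residue_ring (int n))\<^esub> u = \<one>\<^bsub>units_of (residue_ring (int n))\<^esub>"
      unfolding v_def using u' by (rule U.l_inv)
    then have "[v * u = 1] (mod int n)"
      using n by (simp add: units_of_mult units_of_one res_mult_eq res_one_eq Cong.cong_def)
    then have "R (v * u * x) x"
      using cong_mult[of "v * u" 1 "int n" x x] by (intro inv(4)) simp
    moreover have "R (v * (u * x)) (v * x)"
      using u by (intro inv(5) v') (simp add: unit_stab_def)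
    ultimately have "R (v * x) x"
      using inv(2,3) unfolding mult.assoc by blast
    then show "inv\<^bsub>units_of (residue_ring (int n))\<^esub> u \<in> unit_stab n R x"
      using v' unfolding v_def[symmetric] unit_stab_def by simp
  qed
qed

lemma finite_unit_stab: "finite (unit_stab n R x)"
  by (rule finite_subset[of _ "{0..<int n}"]) (auto simp: unit_stab_def)

text \<open>
Lagrange's theorem, applied inside the larger stabilizer and inside the whole group of units.
\<close>

lemma card_unit_stab_dvd:
  assumes n: "n > 1" and R: "unit_invariant n R" "unit_invariant n R'"
    and sub: "unit_stab n R' x \<subseteq> unit_stab n R x"
  shows "card (unit_stab n R' x) dvd card (unit_stab n R x)"
    and "card (unit_stab n R x) dvd totient n"
proof -
  interpret residues "int n" "residue_ring (int n)"
    by unfold_locales (use n in auto)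
  let ?U = "units_of (residue_ring (int n))"
  interpret U: group ?U by (rule units_group)
  have "subgroup (unit_stab n R' x) (?U\<lparr>carrier := unit_stab n R x\<rparr>)"
    using sub by (intro U.subgroup_incl subgroup_unit_stab n R)
  moreover have "group (?U\<lparr>carrier := unit_stab n R x\<rparr>)"
    by (rule subgroup.subgroup_is_group[OF subgroup_unit_stab[OF n R(1)] U.group_axioms])
  ultimately show "card (unit_stab n R' x) dvd card (unit_stab n R x)"
    using group.lagrange[of "?U\<lparr>carrier := unit_stab n R x\<rparr>" "unit_stab n R' x"]
    by (simp add: Coset.order_def) (metis dvd_triv_right)
  have "Coset.order ?U = totient n"
    using totient_eq by (simp add: Coset.order_def units_of_carrier)
  then show "card (unit_stab n R x) dvd totient n"
    using U.lagrange[OF subgroup_unit_stab[OF n R(1), of x]] by (metis dvd_triv_right)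
qed

text \<open>
With \<open>x = y g\<close> and \<open>n = n' g\<close>, where \<open>g = gcd x n\<close>, any \<open>y + k n'\<close> may serve as the factor \<open>u\<close>. It is
coprime to \<open>n\<close> if \<open>k\<close> is the product of the primes that divide \<open>n\<close> but not \<open>y\<close>: a prime factor of \<open>n\<close> then
divides exactly one of the two summands.
\<close>

lemma unit_times_divisor:
  assumes "n > 0"
  obtains u g where "g dvd n" "coprime u (int n)" "[x = u * int g] (mod int n)"
proof -
  define g where "g = gcd x (int n)"
  have g: "g > 0" using assms by (simp add: g_def)
  obtain y n' where y: "x = y * g" and n': "int n = n' * g" and cop: "coprime y n'"
    using gcd_coprime_exists[of x "int n"] g unfolding g_def by auto
  define k where "k = (\<Prod>p\<in>{p \<in> prime_factors (int n). \<not> p dvd y}. p)"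
  define u where "u = y + k * n'"
  have "coprime u (int n)"
  proof (rule ccontr)
    assume "\<not> coprime u (int n)"
    then have "\<bar>gcd u (int n)\<bar> \<noteq> 1" by (simp add: coprime_iff_gcd_eq_1)
    then obtain p where p: "Factorial_Ring.prime p" "p dvd gcd u (int n)"
      using prime_factor_int by blast
    then have p_dvd: "p dvd u" "p dvd int n" by simp_all
    have mem: "p \<in> prime_factors (int n)" using p(1) p_dvd(2) assms by (auto simp: prime_factors_dvd)
    show False
    proof (cases "p dvd y")
      case True
      then have "p dvd k * n'" using p_dvd(1) unfolding u_def by (simp add: dvd_add_right_iff)
      moreover have "\<not> p dvd n'"
        using True cop p(1) by (metis coprime_common_divisor not_prime_unit)
      ultimately have "p dvd k" using p(1) by (simp add: prime_dvd_mult_iff)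
      then obtain q where "q \<in> prime_factors (int n)" "\<not> q dvd y" "p dvd q"
        unfolding k_def using p(1) by (subst (asm) prime_dvd_prod_iff) auto
      then show False using True p(1) by (metis in_prime_factors_imp_prime primes_dvd_imp_eq)
    next
      case False
      then have "p dvd k" unfolding k_def using mem by (intro dvd_prodI) auto
      then show False using False p_dvd(1) unfolding u_def by (simp add: dvd_add_left_iff)
    qed
  qed
  moreover have "[x = u * g] (mod int n)"
    unfolding u_def y n' by (simp add: cong_iff_dvd_diff algebra_simps)
  moreover have "nat g dvd n"
    using g by (simp add: n' flip: int_dvd_int_iff)
  ultimately show ?thesis using that[of "nat g" u] g by simp
qed

text \<open>
The orbit of \<open>g\<close> is linked to the orbit of a smaller divisor. Exactly one divisor in every set of mutually
linked orbits does not have this property, so breaking a link makes it fail for at least one more.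
\<close>

definition linked_below :: "nat \<Rightarrow> (int \<Rightarrow> int \<Rightarrow> bool) \<Rightarrow> nat \<Rightarrow> bool" where
  "linked_below n R g \<longleftrightarrow>
     (\<exists>h<g. h dvd n \<and> (\<exists>u. coprime u (int n) \<and> R (u * int h) (int g)))"

definition potential :: "nat \<Rightarrow> (int \<Rightarrow> int \<Rightarrow> bool) \<Rightarrow> nat" where
  "potential n R = (\<Sum>g | g dvd n.
     bigomega (card (unit_stab n R (int g))) + of_bool (linked_below n R g))"

lemma least_linked:
  assumes n: "n > 1" and R: "unit_invariant n R" and "g dvd n"
  shows "\<exists>h u. h dvd n \<and> \<not> linked_below n R h \<and> coprime u (int n) \<and> R (u * int h) (int g)"
  using \<open>g dvd n\<close>
proof (induction g rule: less_induct)
  case (less g)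
  note inv = unit_invariantD[OF R]
  show ?case
  proof (cases "linked_below n R g")
    case False
    then show ?thesis using less.prems inv(1)
      by (intro exI[of _ g] exI[of _ 1]) auto
  next
    case True
    then obtain h u where h: "h < g" "h dvd n" "coprime u (int n)" "R (u * int h) (int g)"
      unfolding linked_below_def by blast
    obtain h' u' where h': "h' dvd n" "\<not> linked_below n R h'" "coprime u' (int n)"
        "R (u' * int h') (int h)"
      using less.IH[OF h(1,2)] by blast
    have "R (u * (u' * int h')) (u * int h)" by (rule inv(5)[OF h(3) h'(4)])
    then have "R (u * u' * int h') (int g)" using inv(3) h(4) unfolding mult.assoc by blast
    then show ?thesis using h'(1,2,3) h(3) by (intro exI[of _ h'] exI[of _ "u * u'"]) simp
  qed
qed

text \<open>
Every summand of the potential is monotone in the relation, so it is enough to recover \<open>R\<close> from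
\<open>R'\<close> when all summands agree. Each point is \<open>R'\<close>-related to a unit multiple of a divisor that is not
linked below. Two \<open>R\<close>-related points lead in this way to the same divisor \<open>h\<close>, since otherwise the
larger one would be linked below. The two unit multiples of \<open>h\<close> differ by an element of the stabilizer of
\<open>h\<close>, which is the same for \<open>R\<close> and \<open>R'\<close>.
\<close>

lemma potential_less:
  assumes n: "n > 1" and R: "unit_invariant n R" and R': "unit_invariant n R'"
    and le: "\<And>x y. R' x y \<Longrightarrow> R x y" and neq: "R' \<noteq> R"
  shows "potential n R' < potential n R"
proof (rule ccontr)
  assume not_less: "\<not> potential n R' < potential n R"
  let ?f = "\<lambda>R g. bigomega (card (unit_stab n R (int g))) + (of_bool (linked_below n R g) :: nat)"
  have stab_sub: "unit_stab n R' x \<subseteq> unit_stab n R x" for x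
    using le by (auto simp: unit_stab_def)
  have card_pos: "card (unit_stab n R x) \<noteq> 0" for x
    using card_unit_stab_dvd(2)[OF n R R subset_refl, of x] n by (intro notI) simp
  have omega_le: "bigomega (card (unit_stab n R' x)) \<le> bigomega (card (unit_stab n R x))" for x
    by (intro bigomega_mono card_unit_stab_dvd n R R' stab_sub card_pos)
  have link_le: "linked_below n R' g \<Longrightarrow> linked_below n R g" for g
    using le unfolding linked_below_def by blast
  have fin: "finite {g. g dvd n}" using n by simp
  have f_le: "?f R' g \<le> ?f R g" for g
    using omega_le link_le by (intro add_mono) auto
  have f_eq: "?f R' g = ?f R g" if "g dvd n" for g
  proof (rule ccontr)
    assume "?f R' g \<noteq> ?f R g"
    then have "potential n R' < potential n R"
      unfolding potential_def using f_le[of g] that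
      by (intro sum_strict_mono_ex1 fin ballI f_le bexI[of _ g]) auto
    then show False using not_less by blast
  qed
  have stab_eq: "unit_stab n R' (int g) = unit_stab n R (int g)" if "g dvd n" for g
  proof -
    have "bigomega (card (unit_stab n R (int g))) \<le> bigomega (card (unit_stab n R' (int g)))"
      using f_eq[OF that] omega_le[of "int g"] link_le[of g] by (auto simp: of_bool_def split: if_splits)
    then have "card (unit_stab n R' (int g)) = card (unit_stab n R (int g))"
      by (intro bigomega_dvd_eq card_unit_stab_dvd n R R' stab_sub card_pos)
    then show ?thesis by (intro card_subset_eq finite_unit_stab stab_sub)
  qed
  have link_eq: "linked_below n R g \<longleftrightarrow> linked_below n R' g" if "g dvd n" for g
    using f_eq[OF that] omega_le[of "int g"] link_le[of g] by (auto simp: of_bool_def split: if_splits)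
  note inv = unit_invariantD[OF R] and inv' = unit_invariantD[OF R']
  have representative: "\<exists>h a. h dvd n \<and> \<not> linked_below n R h \<and> coprime a (int n) \<and> R' x (a * int h)"
    for x
  proof -
    obtain u g where g: "g dvd n" "coprime u (int n)" "[x = u * int g] (mod int n)"
      using n by (elim unit_times_divisor[OF order_less_trans[OF zero_less_one]])
    obtain h v where h: "h dvd n" "\<not> linked_below n R' h" "coprime v (int n)" "R' (v * int h) (int g)"
      using least_linked[OF n R' g(1)] by blast
    have "R' (u * (v * int h)) (u * int g)" by (rule inv'(5)[OF g(2) h(4)])
    then have "R' x (u * v * int h)"
      using inv'(2,3) inv'(4)[OF g(3)] unfolding mult.assoc by blast
    then show ?thesis using h g(2) link_eq[OF h(1)]
      by (intro exI[of _ h] exI[of _ "u * v"]) simp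
  qed
  \<comment> \<open>dividing by the unit \<open>b\<close> would exhibit \<open>g\<close> as a link below \<open>h\<close>\<close>
  have not_smaller: "\<not> g < h"
    if gh: "g dvd n" "\<not> linked_below n R h" and a: "coprime a (int n)" and b: "coprime b (int n)"
      and rel: "R (a * int g) (b * int h)" for a b g h
  proof
    assume "g < h"
    obtain c where c: "[b * c = 1] (mod int n)" using cong_solve_coprime_int[OF b] by blast
    then have cop: "coprime c (int n)"
      using coprime_iff_invertible_int by (metis mult.commute)
    have "R (c * (a * int g)) (c * (b * int h))" by (rule inv(5)[OF cop rel])
    moreover have "R (c * (b * int h)) (int h)"
      using cong_mult[OF c cong_refl[of "int h"]] by (intro inv(4)) (simp add: ac_simps)
    ultimately have "R (c * a * int g) (int h)" using inv(3) unfolding mult.assoc by blast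
    then have "linked_below n R h"
      unfolding linked_below_def using \<open>g < h\<close> gh(1) a cop
      by (intro exI[of _ g]) (auto intro!: exI[of _ "c * a"])
    then show False using gh(2) by blast
  qed
  have "R' x y" if Rxy: "R x y" for x y
  proof -
    obtain h a where h: "h dvd n" "\<not> linked_below n R h" "coprime a (int n)" "R' x (a * int h)"
      using representative by blast
    obtain k b where k: "k dvd n" "\<not> linked_below n R k" "coprime b (int n)" "R' y (b * int k)"
      using representative by blast
    have Rab: "R (a * int h) (b * int k)"
      using Rxy le[OF h(4)] le[OF k(4)] inv(2,3) by blast
    have "\<not> h < k" by (rule not_smaller[OF h(1) k(2) h(3) k(3) Rab])
    moreover have "\<not> k < h" by (rule not_smaller[OF k(1) h(2) k(3) h(3) inv(2)[OF Rab]])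
    ultimately have "k = h" by simp
    obtain c where c: "[b * c = 1] (mod int n)" using cong_solve_coprime_int[OF k(3)] by blast
    then have cop: "coprime c (int n)"
      using coprime_iff_invertible_int by (metis mult.commute)
    have c_cancel: "[b * (c * z) = z] (mod int n)" for z
      using cong_mult[OF c cong_refl[of z]] by (simp add: mult.assoc)
    have "R (c * (a * int h)) (c * (b * int h))"
      using inv(5)[OF cop Rab] unfolding \<open>k = h\<close> .
    moreover have "R (c * (b * int h)) (int h)"
      using inv(4)[OF c_cancel[of "int h"]] by (simp add: ac_simps)
    ultimately have "R (c * a * int h) (int h)" using inv(3) unfolding mult.assoc by blast
    then have "R' (c * a * int h) (int h)"
      using unit_stab_iff[OF n R, of "c * a"] unit_stab_iff[OF n R', of "c * a"] cop h(3)
        stab_eq[OF h(1)] by simp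
    then have "R' (b * (c * a * int h)) (b * int h)" by (rule inv'(5)[OF k(3)])
    moreover have "R' (b * (c * a * int h)) (a * int h)"
      using inv'(4)[OF c_cancel[of "a * int h"]] by (simp add: mult.assoc)
    ultimately show ?thesis
      using h(4) k(4) inv'(2,3) unfolding \<open>k = h\<close> by blast
  qed
  then have "R' = R" using le by blast
  then show False using neq by blast
qed

lemma potential_le:
  assumes n: "n > 1" and R: "unit_invariant n R"
  shows "potential n R \<le> divisor_count n * (bigomega (totient n) + 1)"
proof -
  have "potential n R \<le> of_nat (divisor_count n) * (bigomega (totient n) + 1)"
    unfolding potential_def divisor_count_def
    by (intro sum_bounded_above add_mono bigomega_mono card_unit_stab_dvd(2)[OF n R R subset_refl])
       (use n in auto)
  then show ?thesis by simp
qed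

lemma unit_invariant_chain_stops:
  fixes R :: "nat \<Rightarrow> int \<Rightarrow> int \<Rightarrow> bool"
  assumes n: "n > 1" and R: "\<And>k. unit_invariant n (R k)"
    and le: "\<And>k x y. R (Suc k) x y \<Longrightarrow> R k x y"
  obtains k where "k \<le> divisor_count n * (bigomega (totient n) + 1)" "R (Suc k) = R k"
proof -
  let ?T = "divisor_count n * (bigomega (totient n) + 1)"
  have "\<exists>k\<le>?T. R (Suc k) = R k"
  proof (rule ccontr)
    assume "\<not> (\<exists>k\<le>?T. R (Suc k) = R k)"
    then have neq: "R (Suc k) \<noteq> R k" if "k \<le> ?T" for k
      using that by blast
    have less: "potential n (R (Suc k)) < potential n (R k)" if "k \<le> ?T" for k
      by (rule potential_less[OF n R R le neq[OF that]])
    have "potential n (R k) + k \<le> potential n (R 0)" if "k \<le> Suc ?T" for k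
      using that
    proof (induction k)
      case (Suc k)
      then show ?case using less[of k] by simp
    qed simp
    from this[of "Suc ?T"] show False using potential_le[OF n R[of 0]] by simp
  qed
  then show ?thesis using that by blast
qed

context cyclic_refinement
begin

lemma unit_invariant_unit_core: "unit_invariant n (unit_core r)"
  unfolding unit_invariant_def using equivp_unit_core cong_imp_unit_core unit_core_mult by blast

text \<open>
Sample the unit-invariant relations \<open>unit_core\<close> once every \<open>Suc l\<close> steps. Once two consecutive
samples agree, the sandwich \<open>P (r + l) \<le> unit_core r \<le> P r\<close> forces two consecutive relations \<open>P\<close> to
agree as well.
\<close>

lemma stable_step:
  assumes l: "n\<^sup>2 < 2 ^ Suc l"
  shows "\<exists>r \<le> (divisor_count n * (bigomega (totient n) + 1) + 1) * Suc l. P (Suc r) = P r"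
proof -
  have "unit_core (k * Suc l) x y" if "unit_core (Suc k * Suc l) x y" for k x y
    by (rule unit_core_antimono[OF _ that]) simp
  then obtain k where k: "k \<le> divisor_count n * (bigomega (totient n) + 1)"
      "unit_core (Suc k * Suc l) = unit_core (k * Suc l)"
    using unit_invariant_chain_stops[of n "\<lambda>k. unit_core (k * Suc l)"] n_gt_1 unit_invariant_unit_core
    by blast
  \<comment> \<open>\<open>P r\<close> lies inside sample \<open>k\<close>, hence inside sample \<open>k + 1\<close>, hence inside
    \<open>P (k * Suc l + Suc l)\<close>, which is the successor of \<open>P r\<close>\<close>
  define r where "r = k * Suc l + l"
  have "P (Suc r) x y" if "P r x y" for x y
  proof -
    have "unit_core (k * Suc l) x y" using P_imp_unit_core[OF l] that unfolding r_def by blast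
    then have "P (Suc k * Suc l) x y" unfolding k(2)[symmetric] by (rule unit_core_imp_P)
    then show ?thesis by (simp add: r_def algebra_simps)
  qed
  then have "P (Suc r) = P r" using P_SucD by blast
  moreover have "r \<le> (divisor_count n * (bigomega (totient n) + 1) + 1) * Suc l"
  proof -
    have "r \<le> (k + 1) * Suc l" by (simp add: r_def)
    also have "\<dots> \<le> (divisor_count n * (bigomega (totient n) + 1) + 1) * Suc l"
      using k(1) by (intro mult_right_mono add_right_mono) auto
    finally show ?thesis .
  qed
  ultimately show ?thesis by blast
qed

end

section \<open>The Weisfeiler-Leman algorithm on a circulant graph\<close>

locale circulant =
  fixes n :: nat and S :: "int set" and G :: "int pair_pre_digraph"
  assumes n_gt_1: "1 < n"
    and G_def: "G = cayley_graph (integer_mod_group n) S"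
    and S_sub: "S \<subseteq> {0..<int n}"
begin

abbreviation V :: "int set" where "V \<equiv> {0..<int n}"

lemma pverts_G: "pverts G = V"
  using n_gt_1 unfolding G_def cayley_graph_def by (simp add: carrier_integer_mod_group)

lemma mod_in_V: "x mod int n \<in> V"
  using n_gt_1 by simp

lemma arc_iff:
  assumes "v \<in> V" "w \<in> V"
  shows "(v, w) \<in> parcs G \<longleftrightarrow> (w - v) mod int n \<in> S"
proof
  assume "(v, w) \<in> parcs G"
  then obtain s where s: "s \<in> S" "w = (s + v) mod int n"
    unfolding G_def cayley_graph_def by auto
  then have "(w - v) mod int n = s mod int n" by (simp add: mod_diff_left_eq)
  also have "\<dots> = s" using s(1) S_sub by auto
  finally show "(w - v) mod int n \<in> S" using s(1) by simp
next
  assume *: "(w - v) mod int n \<in> S"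
  have "w = ((w - v) mod int n + v) mod int n"
    using assms(2) by (simp add: mod_add_left_eq)
  moreover have "(v, (s + v) mod int n) \<in> parcs G" if "s \<in> S" for s
    using that assms(1) n_gt_1 unfolding G_def cayley_graph_def carrier_integer_mod_group by auto
  ultimately show "(v, w) \<in> parcs G" using * by metis
qed

text \<open>
By translation invariance the color of a pair \<open>(v, w)\<close> is that of \<open>(0, w - v)\<close>. Extending it
periodically to all integers avoids reductions modulo \<open>n\<close> in convolutions.
\<close>

definition color :: "nat \<Rightarrow> int \<Rightarrow> wl_color" where
  "color r x = wl_coloring G r (0, x mod int n)"

text \<open>
The multiset computed by one step, for the pair \<open>(0, x)\<close>.
\<close>

definition profile :: "nat \<Rightarrow> int \<Rightarrow> (wl_color \<times> wl_color \<times> wl_color) multiset" where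
  "profile r x = {# (color r x, color r (x - t), color r t). t \<in># mset_set V #}"

lemma color_cong: "[x = y] (mod int n) \<Longrightarrow> color r x = color r y"
  by (simp add: color_def Cong.cong_def)

lemma profile_cong:
  assumes "[x = y] (mod int n)"
  shows "profile r x = profile r y"
proof -
  have "color r (x - t) = color r (y - t)" for t
    by (intro color_cong cong_diff assms) simp
  then show ?thesis unfolding profile_def using color_cong[OF assms] by simp
qed

text \<open>
The substitution \<open>u = t + v\<close> permutes the intermediate vertices and turns the multiset at \<open>(v, w)\<close>
into the one at \<open>(0, w - v)\<close>.
\<close>

lemma wl_coloring_Suc_profile:
  assumes IH: "\<And>v w. v \<in> V \<Longrightarrow> w \<in> V \<Longrightarrow> wl_coloring G r (v, w) = color r (w - v)"
    and vw: "v \<in> V" "w \<in> V"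
  shows "wl_coloring G (Suc r) (v, w) = Refined (profile r (w - v))"
proof -
  let ?h = "\<lambda>t. (t + v) mod int n"
  have inj: "inj_on ?h V"
  proof (rule inj_onI)
    fix s t assume st: "s \<in> V" "t \<in> V" "?h s = ?h t"
    then have "[s + v = t + v] (mod int n)" by (simp add: Cong.cong_def)
    then have "[s = t] (mod int n)" using cong_add_rcancel by blast
    then show "s = t" using st(1,2) by (simp add: Cong.cong_def)
  qed
  have "?h ` V = V"
    by (rule card_subset_eq) (use mod_in_V in \<open>auto simp: card_image[OF inj]\<close>)
  then have V: "mset_set V = image_mset ?h (mset_set V)"
    using image_mset_mset_set[OF inj] by argo
  have "{# (wl_coloring G r (v, w), wl_coloring G r (u, w), wl_coloring G r (v, u)). u \<in># mset_set V #}
      = {# (color r (w - v), color r (w - u), color r (u - v)). u \<in># mset_set V #}"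
    using vw by (intro image_mset_cong) (auto simp: IH)
  also have "\<dots> = {# (color r (w - v), color r (w - ?h t), color r (?h t - v)). t \<in># mset_set V #}"
    by (subst V) (simp add: image_mset.compositionality comp_def)
  also have "\<dots> = profile r (w - v)"
    unfolding profile_def
  proof (intro image_mset_cong)
    fix t
    have "[w - ?h t = w - v - t] (mod int n)"
      by (simp add: Cong.cong_def mod_diff_right_eq diff_diff_eq add.commute)
    moreover have "[?h t - v = t] (mod int n)"
      by (simp add: Cong.cong_def mod_diff_left_eq)
    ultimately show "(color r (w - v), color r (w - ?h t), color r (?h t - v))
        = (color r (w - v), color r (w - v - t), color r t)"
      using color_cong by blast
  qed
  finally show ?thesis
    by (simp add: wl_coloring_def wl_step_def pverts_G)
qed

lemma wl_coloring_0:
  assumes "v \<in> V" "w \<in> V"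
  shows "wl_coloring G 0 (v, w)
    = Initial ((w - v) mod int n = 0) ((w - v) mod int n \<in> S) ((v - w) mod int n \<in> S)"
proof -
  have "(w - v) mod int n = 0 \<longleftrightarrow> w mod int n = v mod int n"
    by (simp add: mod_eq_dvd_iff dvd_eq_mod_eq_0)
  also have "\<dots> \<longleftrightarrow> v = w" using assms by auto
  finally show ?thesis
    using assms by (simp add: wl_coloring_def wl_initial_def arc_iff del: atLeastLessThan_iff)
qed

lemma wl_coloring_translation:
  "v \<in> V \<Longrightarrow> w \<in> V \<Longrightarrow> wl_coloring G r (v, w) = color r (w - v)"
proof (induction r arbitrary: v w)
  case 0
  have zero: "0 \<in> V" using n_gt_1 by simp
  have "wl_coloring G 0 (v, w) = color 0 (w - v)"
    unfolding color_def wl_coloring_0[OF 0] wl_coloring_0[OF zero mod_in_V]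
    by (simp add: mod_simps)
  then show ?case .
next
  case (Suc r)
  have zero: "0 \<in> V" using n_gt_1 by simp
  show ?case
    unfolding color_def
    by (simp only: wl_coloring_Suc_profile[OF Suc.IH Suc.prems]
          wl_coloring_Suc_profile[OF Suc.IH zero mod_in_V])
       (auto intro: profile_cong)
qed

lemma color_Suc: "color (Suc r) x = Refined (profile r x)"
proof -
  have zero: "0 \<in> V" using n_gt_1 by simp
  have "color (Suc r) x = Refined (profile r (x mod int n - 0))"
    unfolding color_def[of "Suc r"]
    by (rule wl_coloring_Suc_profile[OF wl_coloring_translation zero mod_in_V])
  also have "profile r (x mod int n - 0) = profile r x"
    by (rule profile_cong) simp
  finally show ?thesis .
qed

lemma color_SucD:
  assumes "color (Suc r) x = color (Suc r) y"
  shows "color r x = color r y"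
proof -
  have "fst ` set_mset (profile r z) = {color r z}" for z
    using n_gt_1 by (simp add: profile_def image_image image_constant_conv)
  moreover have "profile r x = profile r y"
    using assms by (simp add: color_Suc)
  ultimately show ?thesis by (metis singleton_inject)
qed

text \<open>
A function constant on color classes is a function of the color, and the multiset of triples contains
all pairs of colors that enter the convolution sum.
\<close>

lemma conv_color_invariant:
  assumes a: "\<And>u v. color r u = color r v \<Longrightarrow> a u = a v"
    and b: "\<And>u v. color r u = color r v \<Longrightarrow> b u = b v"
    and xy: "color (Suc r) x = color (Suc r) y"
  shows "cyclic_conv n a b x = cyclic_conv n a b y"
proof -
  define a' where "a' c = a (SOME z. color r z = c)" for c
  define b' where "b' c = b (SOME z. color r z = c)" for c
  have a': "a z = a' (color r z)" for z
    unfolding a'_def by (rule a) (rule sym, rule someI[of _ z], simp)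
  have b': "b z = b' (color r z)" for z
    unfolding b'_def by (rule b) (rule sym, rule someI[of _ z], simp)
  have "cyclic_conv n a b z = (\<Sum>(c, d, e) \<in># profile r z. a' d * b' e)" for z
    unfolding cyclic_conv_def profile_def
    by (simp add: image_mset.compositionality comp_def a' b' sum_unfold_sum_mset)
  then show ?thesis using xy by (simp add: color_Suc)
qed

sublocale cyclic_refinement n "\<lambda>r x y. color r x = color r y"
proof
  show "equivp (\<lambda>x y. color r x = color r y)" for r
    by (auto intro!: equivpI simp: reflp_def symp_def transp_def)
qed (use n_gt_1 color_cong color_SucD conv_color_invariant in blast)+

lemma stable_partition:
  assumes "\<And>x y. color (Suc r) x = color (Suc r) y \<longleftrightarrow> color r x = color r y"
  shows "wl_partition G (Suc r) = wl_partition G r"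
proof -
  have "same_color V (wl_coloring G (Suc r)) = same_color V (wl_coloring G r)"
    by (auto simp: same_color_def wl_coloring_translation assms simp del: atLeastLessThan_iff)
  then show ?thesis by (simp add: wl_partition_def pverts_G)
qed

lemma wl_steps_le:
  assumes "n\<^sup>2 < 2 ^ Suc l"
  shows "wl_steps G \<le> (divisor_count n * (bigomega (totient n) + 1) + 1) * Suc l"
proof -
  obtain r where r: "r \<le> (divisor_count n * (bigomega (totient n) + 1) + 1) * Suc l"
      "(\<lambda>x y. color (Suc r) x = color (Suc r) y) = (\<lambda>x y. color r x = color r y)"
    using stable_step[OF assms] by (elim exE conjE) (rule that)
  have "wl_partition G (Suc r) = wl_partition G r"
    by (rule stable_partition) (rule fun_cong[OF fun_cong[OF r(2)]])
  then have "wl_steps G \<le> r" unfolding wl_steps_def by (rule Least_le)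
  then show ?thesis using r(1) by simp
qed

end

text \<open>
The number \<open>l\<close> of steps after which all unit multipliers have become available is about \<open>2 log\<^sub>2 n\<close>.
\<close>

lemma circulant_graph_wl_steps_le:
  assumes "1 < n" "circulant_graph n G" "n\<^sup>2 < 2 ^ Suc l"
  shows "wl_steps G \<le> (divisor_count n * (bigomega (totient n) + 1) + 1) * Suc l"
proof -
  obtain S where S: "S \<subseteq> carrier (integer_mod_group n) - {\<one>\<^bsub>integer_mod_group n\<^esub>}"
      "G = cayley_graph (integer_mod_group n) S"
    using assms(2) unfolding circulant_graph_def by blast
  interpret circulant n S G
  proof
    show "S \<subseteq> {0..<int n}"
      using S(1) assms(1) by (auto simp: carrier_integer_mod_group)
  qed (rule assms(1) S(2))+
  show ?thesis by (rule wl_steps_le) (rule assms(3))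
qed

section \<open>Divisors and prime factors of typical integers\<close>

lemma sum_inverse_le:
  assumes "N \<ge> 1"
  shows "(\<Sum>m\<in>{1..N}. 1 / real m) \<le> 1 + ln (real N)"
  using assms
proof (induction N rule: dec_induct)
  case (step N)
  have "ln (real N / real (Suc N)) \<le> real N / real (Suc N) - 1"
    using step.hyps by (intro ln_le_minus_one) simp
  also have "\<dots> = - (1 / real (Suc N))" by (simp add: field_simps)
  finally have "1 / real (Suc N) \<le> ln (real (Suc N)) - ln (real N)"
    using step.hyps by (simp add: ln_div)
  then show ?case using step.IH by simp
qed simp

lemma sum_inverse_squares_le: "(\<Sum>q\<in>{2..N}. 1 / real q ^ 2) \<le> 1"
proof -
  have "(\<Sum>q\<in>{2..N}. 1 / real q ^ 2) \<le> 1 - 1 / real (max 1 N)"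
  proof (induction N)
    case (Suc N)
    show ?case
    proof (cases "N = 0")
      case False
      then have "1 / real (Suc N) ^ 2 \<le> 1 / real N - 1 / real (Suc N)"
        by (simp add: divide_simps power2_eq_square)
      then show ?thesis using False Suc.IH by simp
    qed simp
  qed simp
  also have "\<dots> \<le> 1" by simp
  finally show ?thesis .
qed

lemma sum_inverse_powers_le:
  assumes "k \<ge> 2"
  shows "(\<Sum>q\<in>{2..N}. 1 / real q ^ k) \<le> 4 / 2 ^ k"
proof -
  have "(\<Sum>q\<in>{2..N}. 1 / real q ^ k) \<le> (\<Sum>q\<in>{2..N}. 4 / 2 ^ k * (1 / real q ^ 2))"
  proof (rule sum_mono)
    fix q assume q: "q \<in> {2..N}"
    have "(2::real) ^ (k - 2) * real q ^ 2 \<le> real q ^ (k - 2) * real q ^ 2"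
      using q by (intro mult_right_mono power_mono) auto
    also have "\<dots> = real q ^ k"
      unfolding power_add[symmetric] using assms by (simp only: le_add_diff_inverse2)
    also have "(2::real) ^ (k - 2) = 2 ^ k / 4"
      using assms by (simp add: power_diff)
    finally have "2 ^ k / 4 * real q ^ 2 \<le> real q ^ k" .
    then have "1 / real q ^ k \<le> 1 / (2 ^ k / 4 * real q ^ 2)"
      using q by (intro divide_left_mono) auto
    then show "1 / real q ^ k \<le> 4 / 2 ^ k * (1 / real q ^ 2)" by simp
  qed
  also have "\<dots> \<le> 4 / 2 ^ k * 1"
    unfolding sum_distrib_left[symmetric] by (intro mult_left_mono sum_inverse_squares_le) simp
  finally show ?thesis by simp
qed

lemma card_multiples_le:
  assumes "q > 0"
  shows "real (card {m \<in> {1..N}. q dvd m}) \<le> real N / real q"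
proof -
  have "{m \<in> {1..N}. q dvd m} \<subseteq> (\<lambda>j. q * j) ` {1..N div q}"
  proof
    fix m assume "m \<in> {m \<in> {1..N}. q dvd m}"
    then obtain j where j: "m = q * j" "1 \<le> q * j" "q * j \<le> N" by auto
    have "j \<noteq> 0" using j(2) by (intro notI) simp
    moreover have "j \<le> N div q"
      using j(3) assms by (simp add: less_eq_div_iff_mult_less_eq mult.commute)
    ultimately have "j \<in> {1..N div q}" by simp
    then show "m \<in> (\<lambda>j. q * j) ` {1..N div q}" using j(1) by blast
  qed
  then have "card {m \<in> {1..N}. q dvd m} \<le> card ((\<lambda>j. q * j) ` {1..N div q})"
    by (intro card_mono) auto
  also have "\<dots> \<le> N div q" using card_image_le[of "{1..N div q}"] by fastforce
  finally have "real (card {m \<in> {1..N}. q dvd m}) \<le> real (N div q)" by simp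
  also have "\<dots> \<le> real N / real q" by (rule of_nat_div_le_of_nat)
  finally show ?thesis .
qed

lemma sum_inverse_multiples_le:
  assumes "q > 0" "N \<ge> 1"
  shows "(\<Sum>m | m \<in> {1..N} \<and> q dvd m. 1 / real m) \<le> (1 + ln (real N)) / real q"
proof -
  have "(\<Sum>m | m \<in> {1..N} \<and> q dvd m. 1 / real m) \<le> (\<Sum>m\<in>(\<lambda>j. q * j) ` {1..N}. 1 / real m)"
  proof (intro sum_mono2 subsetI)
    fix m assume m: "m \<in> {m. m \<in> {1..N} \<and> q dvd m}"
    then obtain j where j: "m = q * j" by auto
    have "j \<noteq> 0" using m j by (intro notI) simp
    moreover have "j \<le> m" using assms(1) j by simp
    ultimately have "j \<in> {1..N}" using m by simp
    then show "m \<in> (\<lambda>j. q * j) ` {1..N}" using j by blast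
  qed auto
  also have "\<dots> = (\<Sum>j\<in>{1..N}. 1 / real (q * j))"
    using assms(1) by (subst sum.reindex) (auto simp: inj_on_def)
  also have "\<dots> = (\<Sum>j\<in>{1..N}. 1 / real j) / real q"
    by (simp add: sum_divide_distrib mult.commute)
  also have "\<dots> \<le> (1 + ln (real N)) / real q"
    by (intro divide_right_mono sum_inverse_le assms) simp
  finally show ?thesis .
qed

lemma divisor_count_conv_sum:
  assumes "n \<in> {1..N}"
  shows "real (divisor_count n) = (\<Sum>g\<in>{1..N}. if g dvd n then 1 else 0)"
proof -
  have "{g. g dvd n} = {g \<in> {1..N}. g dvd n}"
    using assms by (auto dest: dvd_imp_le intro: Nat.gr0I simp: Suc_le_eq)
  then show ?thesis
    by (simp only: divisor_count_def sum.inter_filter[OF finite_atLeastAtMost, symmetric]) simp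
qed

lemma sum_divisor_count_le:
  assumes "N \<ge> 1"
  shows "(\<Sum>n\<in>{1..N}. real (divisor_count n)) \<le> real N * (1 + ln (real N))"
proof -
  have "(\<Sum>n\<in>{1..N}. real (divisor_count n)) = (\<Sum>n\<in>{1..N}. \<Sum>g\<in>{1..N}. if g dvd n then 1 else 0)"
    by (intro sum.cong refl divisor_count_conv_sum)
  also have "\<dots> = (\<Sum>g\<in>{1..N}. real (card {n \<in> {1..N}. g dvd n}))"
    by (subst sum.swap) (simp add: sum.inter_filter[symmetric])
  also have "\<dots> \<le> (\<Sum>g\<in>{1..N}. real N * (1 / real g))"
    by (intro sum_mono) (use card_multiples_le in auto)
  also have "\<dots> \<le> real N * (1 + ln (real N))"
    unfolding sum_distrib_left[symmetric] by (intro mult_left_mono sum_inverse_le assms) simp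
  finally show ?thesis .
qed

lemma sum_divisor_count_over_le:
  assumes "N \<ge> 1"
  shows "(\<Sum>n\<in>{1..N}. real (divisor_count n) / real n) \<le> (1 + ln (real N))\<^sup>2"
proof -
  have L: "0 \<le> 1 + ln (real N)" using assms by simp
  have "(\<Sum>n\<in>{1..N}. real (divisor_count n) / real n)
      = (\<Sum>n\<in>{1..N}. \<Sum>g\<in>{1..N}. if g dvd n then 1 / real n else 0)"
  proof (rule sum.cong[OF refl])
    fix n assume "n \<in> {1..N}"
    then show "real (divisor_count n) / real n = (\<Sum>g\<in>{1..N}. if g dvd n then 1 / real n else 0)"
      by (simp only: divisor_count_conv_sum sum_divide_distrib) (intro sum.cong, auto)
  qed
  also have "\<dots> = (\<Sum>g\<in>{1..N}. \<Sum>n | n \<in> {1..N} \<and> g dvd n. 1 / real n)"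
    by (subst sum.swap) (simp only: sum.inter_filter[OF finite_atLeastAtMost, symmetric])
  also have "\<dots> \<le> (\<Sum>g\<in>{1..N}. (1 + ln (real N)) * (1 / real g))"
    by (intro sum_mono) (use sum_inverse_multiples_le[OF _ assms] in auto)
  also have "\<dots> \<le> (1 + ln (real N)) * (1 + ln (real N))"
    unfolding sum_distrib_left[symmetric] by (intro mult_left_mono sum_inverse_le assms L)
  finally show ?thesis by (simp add: power2_eq_square)
qed

text \<open>
Distinct sets of prime factors have distinct products, all of which divide \<open>n\<close>.
\<close>

lemma two_power_omega_le_divisor_count:
  assumes "n > 0"
  shows "2 ^ card (prime_factors n) \<le> divisor_count n"
proof -
  have dvd: "\<Prod>A dvd n" if "A \<subseteq> prime_factors n" for A
  proof -
    have "\<Prod>A dvd \<Prod>(prime_factors n)" using that by (intro prod_dvd_prod_subset) auto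
    also have "\<dots> dvd (\<Prod>p\<in>prime_factors n. p ^ multiplicity p n)"
      by (intro prod_dvd_prod dvd_power) (auto simp: prime_factors_multiplicity)
    also have "\<dots> = n" using prime_factorization_nat[OF assms] by simp
    finally show ?thesis .
  qed
  have inj: "inj_on \<Prod> (Pow (prime_factors n))"
  proof (rule inj_onI)
    have mem: "p \<in> A \<longleftrightarrow> p dvd \<Prod>A"
      if "A \<subseteq> prime_factors n" "Factorial_Ring.prime p" for A p
    proof -
      have "finite A" using that(1) by (rule finite_subset) simp
      then have "p dvd \<Prod>A \<longleftrightarrow> (\<exists>q\<in>A. p dvd q)" using that(2) by (rule prime_dvd_prod_iff)
      also have "\<dots> \<longleftrightarrow> p \<in> A"
        using that by (metis dvd_refl in_prime_factors_imp_prime primes_dvd_imp_eq subsetD)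
      finally show ?thesis by simp
    qed
    fix A B assume "A \<in> Pow (prime_factors n)" "B \<in> Pow (prime_factors n)" "\<Prod>A = \<Prod>B"
    then show "A = B" using mem[of A] mem[of B] by (metis PowD in_prime_factors_imp_prime subsetD subsetI subset_antisym)
  qed
  have "2 ^ card (prime_factors n) = card (\<Prod> ` Pow (prime_factors n))"
    using card_image[OF inj] by (simp add: card_Pow)
  also have "\<dots> \<le> divisor_count n"
    unfolding divisor_count_def using assms dvd by (intro card_mono) auto
  finally show ?thesis .
qed

lemma bigomega_conv_sum: "bigomega n = (\<Sum>p\<in>prime_factors n. multiplicity p n)"
  unfolding bigomega_def size_multiset_overloaded_eq
  by (intro sum.cong refl count_prime_factorization_prime) auto

lemma bigomega_mult: "a \<noteq> 0 \<Longrightarrow> b \<noteq> 0 \<Longrightarrow> bigomega (a * b) = bigomega a + bigomega b"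
  by (simp add: bigomega_def prime_factorization_mult)

lemma bigomega_prod:
  "finite A \<Longrightarrow> (\<And>x. x \<in> A \<Longrightarrow> f x \<noteq> 0) \<Longrightarrow> bigomega (\<Prod>x\<in>A. f x) = (\<Sum>x\<in>A. bigomega (f x))"
  by (induction A rule: finite_induct) (auto simp: bigomega_mult, simp add: bigomega_def)

lemma bigomega_prime_power: "Factorial_Ring.prime p \<Longrightarrow> bigomega (p ^ a) = a"
  by (simp add: bigomega_def prime_factorization_prime_power)

text \<open>
By the product formula for the totient, only the exponents in \<open>n\<close> and the numbers \<open>p - 1\<close> have to be
controlled.
\<close>

lemma bigomega_totient:
  assumes "n > 0"
  shows "bigomega (totient n) = (\<Sum>p\<in>prime_factors n. (multiplicity p n - 1) + bigomega (p - 1))"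
proof -
  have "totient n = (\<Prod>p\<in>prime_factors n. p ^ (multiplicity p n - 1) * (p - 1))"
    using assms by (intro totient_formula1)
  moreover have "p ^ (multiplicity p n - 1) \<noteq> 0 \<and> p - 1 \<noteq> 0" if "p \<in> prime_factors n" for p
    using prime_gt_1_nat[OF in_prime_factors_imp_prime[OF that]] by simp
  ultimately show ?thesis
    by (simp add: bigomega_prod bigomega_mult bigomega_prime_power in_prime_factors_imp_prime)
qed

text \<open>
Bounding distinct prime factors and exponents separately, instead of \<open>bigomega\<close>, lets the two
kinds of exceptions be counted by the divisor function and by multiples of \<open>k\<close>-th powers.
\<close>

definition few_factors :: "nat \<Rightarrow> nat \<Rightarrow> bool" where
  "few_factors k m \<longleftrightarrow> card (prime_factors m) < k \<and> (\<forall>p. Factorial_Ring.prime p \<longrightarrow> \<not> p ^ k dvd m)"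

lemma few_factors_multiplicity_less:
  assumes "few_factors k m" "m > 0" "Factorial_Ring.prime p"
  shows "multiplicity p m < k"
proof (rule ccontr)
  assume "\<not> multiplicity p m < k"
  then have "p ^ k dvd m" by (intro multiplicity_dvd') simp
  then show False using assms by (simp add: few_factors_def)
qed

lemma few_factors_bigomega_le:
  assumes "few_factors (Suc K) m" "m > 0"
  shows "bigomega m \<le> K * K"
proof -
  have "bigomega m \<le> of_nat (card (prime_factors m)) * K"
    unfolding bigomega_conv_sum
  proof (rule sum_bounded_above)
    fix p assume "p \<in> prime_factors m"
    from few_factors_multiplicity_less[OF assms in_prime_factors_imp_prime[OF this]]
    show "multiplicity p m \<le> K" by simp
  qed
  also have "\<dots> \<le> K * K"
    using assms(1) by (intro mult_right_mono) (auto simp: few_factors_def)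
  finally show ?thesis .
qed

lemma few_factors_bigomega_totient_le:
  assumes "n > 0" "few_factors (Suc K) n"
    and "\<And>p. p \<in> prime_factors n \<Longrightarrow> few_factors (Suc K) (p - 1)"
  shows "bigomega (totient n) \<le> K * (K + K * K)"
proof -
  have "bigomega (totient n) \<le> of_nat (card (prime_factors n)) * (K + K * K)"
    unfolding bigomega_totient[OF assms(1)]
  proof (intro sum_bounded_above add_mono)
    fix p assume p: "p \<in> prime_factors n"
    then have prime: "Factorial_Ring.prime p" by (rule in_prime_factors_imp_prime)
    show "multiplicity p n - 1 \<le> K"
      using few_factors_multiplicity_less[OF assms(2,1) prime] by simp
    show "bigomega (p - 1) \<le> K * K"
      using prime_gt_1_nat[OF prime] by (intro few_factors_bigomega_le assms(3) p) simp
  qed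
  also have "\<dots> \<le> K * (K + K * K)"
    using assms(2) by (intro mult_right_mono) (auto simp: few_factors_def)
  finally show ?thesis .
qed

text \<open>
The right-hand side majorizes the indicator of the exceptional set by sums that can be evaluated by
counting multiples. The sum runs over all bases \<open>q\<close>, prime or not, which loses only a constant factor.
\<close>

lemma many_factors_indicator_le:
  assumes "n \<in> {1..N}" "k \<ge> 2" "\<not> few_factors k n"
  shows "1 \<le> real (divisor_count n) / 2 ^ k + (\<Sum>q\<in>{2..N}. if q ^ k dvd n then 1 else 0)"
proof (cases "card (prime_factors n) < k")
  case False
  then have "(2::nat) ^ k \<le> 2 ^ card (prime_factors n)" by (intro power_increasing) auto
  also have "\<dots> \<le> divisor_count n" using assms(1) by (intro two_power_omega_le_divisor_count) simp
  finally have "real (2 ^ k) \<le> real (divisor_count n)" by (simp only: of_nat_le_iff)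
  then have "1 \<le> real (divisor_count n) / 2 ^ k" by simp
  moreover have "0 \<le> (\<Sum>q\<in>{2..N}. if q ^ k dvd n then 1 else (0::real))" by (intro sum_nonneg) simp
  ultimately show ?thesis by linarith
next
  case True
  then obtain p where p: "Factorial_Ring.prime p" "p ^ k dvd n"
    using assms(3) by (auto simp: few_factors_def)
  have "p dvd p ^ k" using assms(2) by (intro dvd_power) simp
  then have "p dvd n" using p(2) by (rule dvd_trans)
  then have "p \<in> {2..N}" using assms(1) prime_ge_2_nat[OF p(1)] dvd_imp_le[of p n] by auto
  then have "(if p ^ k dvd n then 1 else (0::real)) \<le> (\<Sum>q\<in>{2..N}. if q ^ k dvd n then 1 else 0)"
    by (intro member_le_sum) auto
  then have "1 \<le> (\<Sum>q\<in>{2..N}. if q ^ k dvd n then 1 else (0::real))" using p(2) by simp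
  moreover have "0 \<le> real (divisor_count n) / 2 ^ k" by simp
  ultimately show ?thesis by linarith
qed

lemma sum_inverse_many_factors_le:
  assumes "N \<ge> 1" "k \<ge> 2"
  shows "(\<Sum>m | m \<in> {1..N} \<and> \<not> few_factors k m. 1 / real m)
    \<le> ((1 + ln (real N))\<^sup>2 + 4 * (1 + ln (real N))) / 2 ^ k"
proof -
  let ?L = "1 + ln (real N)"
  have L: "0 \<le> ?L" using assms by simp
  have "(\<Sum>m | m \<in> {1..N} \<and> \<not> few_factors k m. 1 / real m)
      \<le> (\<Sum>m | m \<in> {1..N} \<and> \<not> few_factors k m. real (divisor_count m) / real m / 2 ^ k
            + (\<Sum>q\<in>{2..N}. if q ^ k dvd m then 1 / real m else 0))"
  proof (rule sum_mono)
    fix m assume "m \<in> {m. m \<in> {1..N} \<and> \<not> few_factors k m}"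
    then have "1 * (1 / real m) \<le> (real (divisor_count m) / 2 ^ k
        + (\<Sum>q\<in>{2..N}. if q ^ k dvd m then 1 else 0)) * (1 / real m)"
      by (intro mult_right_mono many_factors_indicator_le assms) auto
    also have "\<dots> = real (divisor_count m) / real m / 2 ^ k
        + (\<Sum>q\<in>{2..N}. if q ^ k dvd m then 1 / real m else 0)"
      unfolding distrib_right sum_distrib_right
      by (intro arg_cong2[where f = "(+)"] sum.cong) auto
    finally show "1 / real m \<le> real (divisor_count m) / real m / 2 ^ k
        + (\<Sum>q\<in>{2..N}. if q ^ k dvd m then 1 / real m else 0)" by simp
  qed
  also have "\<dots> \<le> (\<Sum>m\<in>{1..N}. real (divisor_count m) / real m / 2 ^ k
            + (\<Sum>q\<in>{2..N}. if q ^ k dvd m then 1 / real m else 0))"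
    by (intro sum_mono2) (auto intro!: add_nonneg_nonneg sum_nonneg)
  also have "\<dots> = (\<Sum>m\<in>{1..N}. real (divisor_count m) / real m) / 2 ^ k
      + (\<Sum>q\<in>{2..N}. \<Sum>m | m \<in> {1..N} \<and> q ^ k dvd m. 1 / real m)"
    unfolding sum.distrib sum_divide_distrib[symmetric]
    by (subst sum.swap) (simp only: sum.inter_filter[OF finite_atLeastAtMost, symmetric])
  also have "\<dots> \<le> ?L\<^sup>2 / 2 ^ k + (\<Sum>q\<in>{2..N}. ?L * (1 / real q ^ k))"
  proof (intro add_mono divide_right_mono sum_divisor_count_over_le sum_mono assms)
    fix q assume "q \<in> {2..N}"
    then show "(\<Sum>m | m \<in> {1..N} \<and> q ^ k dvd m. 1 / real m) \<le> ?L * (1 / real q ^ k)"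
      using sum_inverse_multiples_le[of "q ^ k" N] assms(1) by simp
  qed simp
  also have "\<dots> \<le> ?L\<^sup>2 / 2 ^ k + ?L * (4 / 2 ^ k)"
    unfolding sum_distrib_left[symmetric]
    by (intro add_left_mono mult_left_mono sum_inverse_powers_le assms L)
  finally show ?thesis by (simp add: add_divide_distrib mult.commute)
qed

lemma sum_multiples_indicator_le:
  assumes "q > 0"
  shows "(\<Sum>n\<in>{1..N}. if q dvd n then 1 else 0) \<le> real N * (1 / real q)"
  using card_multiples_le[OF assms, of N] by (simp add: sum.inter_filter[symmetric])

text \<open>
The primality of \<open>p\<close> is given up here; the exponential gain in \<open>k\<close> pays for it.
\<close>

lemma sum_inverse_shifted_many_factors_le:
  assumes "N \<ge> 1" "k \<ge> 2"
  shows "(\<Sum>p | p \<in> {2..N} \<and> \<not> few_factors k (p - 1). 1 / real p)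
    \<le> ((1 + ln (real N))\<^sup>2 + 4 * (1 + ln (real N))) / 2 ^ k"
proof -
  let ?P = "{p. p \<in> {2..N} \<and> \<not> few_factors k (p - 1)}"
  have "(\<Sum>p\<in>?P. 1 / real p) \<le> (\<Sum>p\<in>?P. 1 / real (p - 1))"
    by (intro sum_mono divide_left_mono) auto
  also have "\<dots> = (\<Sum>m\<in>(\<lambda>p. p - 1) ` ?P. 1 / real m)"
    by (subst sum.reindex) (auto simp: inj_on_def)
  also have "\<dots> \<le> (\<Sum>m | m \<in> {1..N} \<and> \<not> few_factors k m. 1 / real m)"
    by (intro sum_mono2) auto
  also have "\<dots> \<le> ((1 + ln (real N))\<^sup>2 + 4 * (1 + ln (real N))) / 2 ^ k"
    by (rule sum_inverse_many_factors_le[OF assms])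
  finally show ?thesis .
qed

text \<open>
A union bound: an exceptional \<open>n\<close> has many prime factors itself, or it is a multiple of one of the
rare integers \<open>p\<close> for which \<open>p - 1\<close> has many.
\<close>

lemma card_many_factors_le:
  assumes "N \<ge> 1" "k \<ge> 2"
  shows "real (card {n \<in> {1..N}. \<not> few_factors k n \<or> (\<exists>p\<in>prime_factors n. \<not> few_factors k (p - 1))})
    \<le> real N * ((ln (real N) + 4)\<^sup>2 / 2 ^ k)"
proof -
  let ?L = "ln (real N)"
  let ?P = "{p. p \<in> {2..N} \<and> \<not> few_factors k (p - 1)}"
  let ?X = "{n \<in> {1..N}. \<not> few_factors k n \<or> (\<exists>p\<in>prime_factors n. \<not> few_factors k (p - 1))}"
  let ?f = "\<lambda>n. real (divisor_count n) / 2 ^ k + (\<Sum>q\<in>{2..N}. if q ^ k dvd n then 1 else 0)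
      + (\<Sum>p\<in>?P. if p dvd n then 1 else 0)"
  have L: "0 \<le> ?L" using assms by simp
  have finP: "finite ?P" by simp
  have nonneg: "0 \<le> (\<Sum>q\<in>{2..N}. if q ^ k dvd n then 1 else (0::real))"
    "0 \<le> (\<Sum>p\<in>?P. if p dvd n then 1 else (0::real))" for n
    by (intro sum_nonneg; simp)+
  have "real (card ?X) = (\<Sum>n\<in>?X. 1)" by simp
  also have "\<dots> \<le> (\<Sum>n\<in>?X. ?f n)"
  proof (rule sum_mono)
    fix n assume n: "n \<in> ?X"
    show "1 \<le> ?f n"
    proof (cases "few_factors k n")
      case False
      then show ?thesis
        using many_factors_indicator_le[of n N k] n assms(2) nonneg(2)[of n] by simp
    next
      case True
      then obtain p where p: "p \<in> prime_factors n" "\<not> few_factors k (p - 1)" using n by blast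
      have dvd: "p dvd n" using p(1) by (rule in_prime_factors_imp_dvd)
      have "2 \<le> p" using p(1) by (intro prime_ge_2_nat in_prime_factors_imp_prime)
      moreover have "p \<le> N" using dvd_imp_le[OF dvd] n by simp
      ultimately have "p \<in> ?P" using p(2) by simp
      then have "(if p dvd n then 1 else (0::real)) \<le> (\<Sum>p\<in>?P. if p dvd n then 1 else 0)"
        by (intro member_le_sum finP) auto
      then have "1 \<le> (\<Sum>p\<in>?P. if p dvd n then 1 else (0::real))" using dvd by simp
      moreover have "0 \<le> real (divisor_count n) / 2 ^ k" by simp
      ultimately show ?thesis using nonneg(1)[of n] by linarith
    qed
  qed
  also have "\<dots> \<le> (\<Sum>n\<in>{1..N}. ?f n)"
    by (intro sum_mono2 add_nonneg_nonneg nonneg) auto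
  also have "\<dots> = (\<Sum>n\<in>{1..N}. real (divisor_count n)) / 2 ^ k
      + (\<Sum>q\<in>{2..N}. \<Sum>n\<in>{1..N}. if q ^ k dvd n then 1 else 0)
      + (\<Sum>p\<in>?P. \<Sum>n\<in>{1..N}. if p dvd n then 1 else 0)"
    unfolding sum.distrib sum_divide_distrib[symmetric]
    by (simp only: sum.swap[of _ "{1..N}" "{2..N}"] sum.swap[of _ "{1..N}" ?P])
  also have "\<dots> \<le> real N * (1 + ?L) / 2 ^ k
      + (\<Sum>q\<in>{2..N}. real N * (1 / real q ^ k)) + (\<Sum>p\<in>?P. real N * (1 / real p))"
  proof (intro add_mono divide_right_mono sum_divisor_count_le sum_mono assms)
    fix q assume "q \<in> {2..N}"
    then show "(\<Sum>n\<in>{1..N}. if q ^ k dvd n then 1 else 0) \<le> real N * (1 / real q ^ k)"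
      using sum_multiples_indicator_le[of "q ^ k" N] by simp
  next
    fix p assume "p \<in> ?P"
    then show "(\<Sum>n\<in>{1..N}. if p dvd n then 1 else 0) \<le> real N * (1 / real p)"
      by (intro sum_multiples_indicator_le) auto
  qed simp
  also have "\<dots> \<le> real N * (1 + ?L) / 2 ^ k + real N * (4 / 2 ^ k)
      + real N * (((1 + ?L)\<^sup>2 + 4 * (1 + ?L)) / 2 ^ k)"
    unfolding sum_distrib_left[symmetric]
    by (intro add_mono mult_left_mono sum_inverse_powers_le
          sum_inverse_shifted_many_factors_le assms order_refl) auto
  also have "\<dots> = real N * (((1 + ?L) + 4 + ((1 + ?L)\<^sup>2 + 4 * (1 + ?L))) / 2 ^ k)"
    by (simp only: add_divide_distrib distrib_left times_divide_eq_right)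
  also have "\<dots> \<le> real N * ((?L + 4)\<^sup>2 / 2 ^ k)"
    using L by (intro mult_left_mono divide_right_mono) (auto simp: power2_eq_square algebra_simps)
  finally show ?thesis .
qed

lemma card_many_divisors_le:
  assumes "N \<ge> 1" "t > 0"
  shows "real (card {n \<in> {1..N}. real (divisor_count n) > t}) \<le> real N * ((1 + ln (real N)) / t)"
proof -
  let ?X = "{n \<in> {1..N}. real (divisor_count n) > t}"
  have "real (card ?X) * t = (\<Sum>n\<in>?X. t)" by simp
  also have "\<dots> \<le> (\<Sum>n\<in>?X. real (divisor_count n))" by (intro sum_mono) auto
  also have "\<dots> \<le> (\<Sum>n\<in>{1..N}. real (divisor_count n))" by (intro sum_mono2) auto
  also have "\<dots> \<le> real N * (1 + ln (real N))" by (rule sum_divisor_count_le[OF assms(1)])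
  finally show ?thesis using assms(2) by (simp add: field_simps)
qed

lemma almost_allI:
  assumes "eventually (\<lambda>N. real (card {n \<in> {1..N}. \<not> P n}) \<le> real N * g N) sequentially"
    and "g \<longlonglongrightarrow> 0"
  shows "almost_all P"
proof -
  let ?b = "\<lambda>N. real (card {n \<in> {1..N}. \<not> P n}) / real N"
  have "?b \<longlonglongrightarrow> 0"
  proof (rule tendsto_sandwich[OF _ _ tendsto_const assms(2)])
    show "eventually (\<lambda>N. ?b N \<le> g N) sequentially"
      using assms(1) eventually_gt_at_top[of 0]
      by eventually_elim (simp add: field_simps)
  qed simp
  then have "(\<lambda>N. 1 - ?b N) \<longlonglongrightarrow> 1 - 0" by (intro tendsto_intros)
  moreover have "eventually (\<lambda>N. 1 - ?b N = real (card {n \<in> {1..N}. P n}) / real N) sequentially"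
    using eventually_gt_at_top[of 0]
  proof eventually_elim
    case (elim N)
    have "card {n \<in> {1..N}. P n} + card {n \<in> {1..N}. \<not> P n}
        = card ({n \<in> {1..N}. P n} \<union> {n \<in> {1..N}. \<not> P n})"
      by (intro card_Un_disjoint[symmetric]) auto
    also have "{n \<in> {1..N}. P n} \<union> {n \<in> {1..N}. \<not> P n} = {1..N}" by auto
    finally have "real (card {n \<in> {1..N}. P n}) = real N - real (card {n \<in> {1..N}. \<not> P n})"
      by (simp flip: of_nat_add)
    then show ?case using elim by (simp add: diff_divide_distrib)
  qed
  ultimately show ?thesis
    unfolding almost_all_def by (simp add: filterlim_cong)
qed

text \<open>
The three terms bound the densities of the integers with many divisors, with many prime factors
(after a choice of \<open>k \<ge> (log N)\<^sup>\<eta>\<close>), and up to \<open>sqrt N\<close>.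
\<close>

lemma exceptional_density_tendsto:
  fixes \<delta> \<eta> :: real
  assumes "\<delta> > 0" "\<eta> > 0"
  shows "(\<lambda>N. (1 + ln (real N)) / ln (real N) powr (1 + \<delta>)
      + (ln (real N) + 4)\<^sup>2 / 2 powr (ln (real N) powr \<eta>) + 1 / sqrt (real N)) \<longlonglongrightarrow> 0"
proof -
  have "(\<lambda>N. (1 + ln (real N)) / ln (real N) powr (1 + \<delta>)) \<longlonglongrightarrow> 0"
    using assms(1) by real_asymp
  moreover have "((\<lambda>x::real. (x + 4)\<^sup>2 / 2 powr (x powr \<eta>)) \<longlongrightarrow> 0) at_top"
    using assms(2) by real_asymp
  then have "(\<lambda>N. (ln (real N) + 4)\<^sup>2 / 2 powr (ln (real N) powr \<eta>)) \<longlonglongrightarrow> 0"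
    by (rule filterlim_compose)
       (rule filterlim_compose[OF ln_at_top filterlim_real_sequentially])
  moreover have "(\<lambda>N. 1 / sqrt (real N)) \<longlonglongrightarrow> 0" by real_asymp
  ultimately have "(\<lambda>N. (1 + ln (real N)) / ln (real N) powr (1 + \<delta>)
      + (ln (real N) + 4)\<^sup>2 / 2 powr (ln (real N) powr \<eta>) + 1 / sqrt (real N))
      \<longlonglongrightarrow> 0 + 0 + 0"
    by (intro tendsto_add)
  then show ?thesis by simp
qed

section \<open>The logarithmic bound\<close>

text \<open>
The exponents add up as \<open>(1 + \<epsilon>/2) + \<epsilon>/2 + 1\<close>, from \<open>d(n)\<close>, from \<open>\<Omega>(\<phi>(n)) \<le> 2 K\<^sup>3\<close>, and from \<open>l\<close>.
The constant \<open>90 = 18 \<cdot> 5\<close> combines \<open>\<Omega>(\<phi>(n)) + 2 \<le> 18 (log N)\<^bsup>\<epsilon>/2\<^esup>\<close> with \<open>l + 1 \<le> 5 log N\<close>.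
\<close>

lemma wl_steps_le_of_bounds:
  assumes n: "2 \<le> n" "n \<le> N" and N: "3 \<le> N" and G: "circulant_graph n G"
    and d: "real (divisor_count n) \<le> ln (real N) powr (1 + \<epsilon> / 2)"
    and few: "few_factors (Suc K) n" "\<And>p. p \<in> prime_factors n \<Longrightarrow> few_factors (Suc K) (p - 1)"
    and K: "real K \<le> 2 * ln (real N) powr (\<epsilon> / 6)" and "\<epsilon> > 0"
  shows "real (wl_steps G) \<le> 90 * ln (real N) powr (2 + \<epsilon>)"
proof -
  define L where "L = ln (real N)"
  have L: "1 \<le> L"
    unfolding L_def using N exp_le by (subst ln_ge_iff) linarith+
  define l where "l = nat \<lfloor>2 * log 2 (real n)\<rfloor>"
  have log_nonneg: "0 \<le> log 2 (real n)" using n by simp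
  have l_lower: "2 * log 2 (real n) < real (Suc l)"
    unfolding l_def using log_nonneg by linarith
  have l_upper: "real l \<le> 2 * log 2 (real n)"
    unfolding l_def using log_nonneg by linarith
  have "real n ^ 2 = (2 powr log 2 (real n)) powr 2"
    using n by simp
  also have "\<dots> = 2 powr (2 * log 2 (real n))"
    by (simp add: powr_powr mult.commute)
  also have "\<dots> < 2 powr real (Suc l)" using l_lower by (intro powr_less_mono) auto
  also have "\<dots> = 2 ^ Suc l" by (rule powr_realpow) simp
  finally have "real (n\<^sup>2) < real (2 ^ Suc l)" by simp
  then have nl: "n\<^sup>2 < 2 ^ Suc l" by (simp only: of_nat_less_iff)
  have ln2: "1 / 2 \<le> ln (2::real)"
    using ln_le_minus_one[of "1 / 2 :: real"] by (simp add: ln_div)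
  have "log 2 (real n) \<le> L / ln 2"
    unfolding L_def log_def using n by (intro divide_right_mono) auto
  also have "\<dots> \<le> L / (1 / 2)"
    using L ln2 by (intro divide_left_mono) auto
  finally have l5: "real (Suc l) \<le> 5 * L" using l_upper L by simp
  let ?d = "divisor_count n"
  let ?w = "bigomega (totient n)"
  have d1: "1 \<le> ?d"
  proof -
    have "1 \<in> {g. g dvd n}" by simp
    then have "card {g. g dvd n} \<noteq> 0" using n by (auto simp: card_eq_0_iff)
    then show ?thesis by (simp add: divisor_count_def)
  qed
  have pw: "1 \<le> L powr (\<epsilon> / 2)" using L \<open>\<epsilon> > 0\<close> by (intro ge_one_powr_ge_zero) auto
  have w: "real ?w \<le> 16 * L powr (\<epsilon> / 2)"
  proof (cases "K = 0")
    case True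
    then show ?thesis
      using few_factors_bigomega_totient_le[OF _ few] n pw by simp
  next
    case False
    have "?w \<le> K * (K + K * K)"
      using n by (intro few_factors_bigomega_totient_le few) auto
    also have "\<dots> \<le> K * (K * K + K * K)"
      using False by (intro mult_left_mono add_right_mono) auto
    also have "\<dots> = 2 * K ^ 3" by (simp add: power3_eq_cube)
    finally have "real ?w \<le> real (2 * K ^ 3)" by (simp only: of_nat_le_iff)
    then have "real ?w \<le> 2 * real K ^ 3" by simp
    also have "\<dots> \<le> 2 * (2 * L powr (\<epsilon> / 6)) ^ 3"
      using K unfolding L_def by (intro mult_left_mono power_mono) auto
    also have "\<dots> = 16 * L powr (\<epsilon> / 2)"
      using L by (simp add: power_mult_distrib powr_power)
    finally show ?thesis .
  qed
  have "wl_steps G \<le> (?d * (?w + 1) + 1) * Suc l"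
    using n by (intro circulant_graph_wl_steps_le G nl) simp
  also have "\<dots> \<le> (?d * (?w + 1) + ?d) * Suc l"
    using d1 by (intro mult_right_mono add_left_mono) auto
  also have "\<dots> = ?d * (?w + 2) * Suc l" by (simp add: algebra_simps)
  finally have "real (wl_steps G) \<le> real (?d * (?w + 2) * Suc l)" by (simp only: of_nat_le_iff)
  also have "\<dots> = real ?d * (real ?w + 2) * real (Suc l)"
    by (simp only: of_nat_mult of_nat_add of_nat_numeral)
  also have "\<dots> \<le> L powr (1 + \<epsilon> / 2) * (18 * L powr (\<epsilon> / 2)) * (5 * L)"
    using d w pw l5 L unfolding L_def[symmetric]
    by (intro mult_mono mult_nonneg_nonneg) auto
  also have "\<dots> = 90 * (L powr (1 + \<epsilon> / 2) * L powr (\<epsilon> / 2) * L powr 1)"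
    using L by simp
  also have "\<dots> = 90 * L powr (2 + \<epsilon>)"
    unfolding powr_add[symmetric] by simp
  finally show ?thesis unfolding L_def .
qed

text \<open>
The exceptional sets are defined by powers of \<open>log N\<close> and not of \<open>log n\<close>. Discarding the \<open>n \<le> sqrt N\<close>
gives \<open>log N \<le> 2 log n\<close> for the others, and the factor is absorbed into the constant.
\<close>

theorem corollary2:
  fixes \<epsilon> :: real
  assumes "\<epsilon> > 0"
  shows "\<exists>C>0. almost_all (\<lambda>n. \<forall>G. circulant_graph n G \<longrightarrow>
           real (wl_steps G) \<le> C * ln (real n) powr (2 + \<epsilon>))"
proof -
  define C where "C = 90 * 2 powr (2 + \<epsilon>)"
  let ?Q = "\<lambda>n. \<forall>G. circulant_graph n G \<longrightarrow> real (wl_steps G) \<le> C * ln (real n) powr (2 + \<epsilon>)"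
  let ?g = "\<lambda>N. (1 + ln (real N)) / ln (real N) powr (1 + \<epsilon> / 2)
      + (ln (real N) + 4)\<^sup>2 / 2 powr (ln (real N) powr (\<epsilon> / 6)) + 1 / sqrt (real N)"
  have bound: "real (card {n \<in> {1..N}. \<not> ?Q n}) \<le> real N * ?g N" if N: "N \<ge> 3" for N
  proof -
    define L where "L = ln (real N)"
    have L: "1 \<le> L"
      unfolding L_def using N exp_le by (subst ln_ge_iff) linarith+
    define t where "t = L powr (1 + \<epsilon> / 2)"
    define K where "K = nat \<lceil>L powr (\<epsilon> / 6)\<rceil>"
    have pw: "1 \<le> L powr (\<epsilon> / 6)" using L assms by (intro ge_one_powr_ge_zero) auto
    have K: "L powr (\<epsilon> / 6) \<le> real K" "real K \<le> 2 * L powr (\<epsilon> / 6)" "1 \<le> K"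
      unfolding K_def using pw by linarith+
    have t: "t > 0" unfolding t_def using L by simp
    let ?A = "{n \<in> {1..N}. real (divisor_count n) > t}"
    let ?B = "{n \<in> {1..N}. \<not> few_factors (Suc K) n
        \<or> (\<exists>p\<in>prime_factors n. \<not> few_factors (Suc K) (p - 1))}"
    let ?S = "{1..nat \<lfloor>sqrt (real N)\<rfloor>}"
    have "{n \<in> {1..N}. \<not> ?Q n} \<subseteq> ?A \<union> ?B \<union> ?S"
    proof (rule subsetI, rule ccontr)
      fix n assume n: "n \<in> {n \<in> {1..N}. \<not> ?Q n}" and not_bad: "n \<notin> ?A \<union> ?B \<union> ?S"
      have nN: "1 \<le> n" "n \<le> N" using n by auto
      have "\<not> n \<le> nat \<lfloor>sqrt (real N)\<rfloor>" using not_bad nN by auto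
      then have sqrt_less: "sqrt (real N) < real n" by linarith
      moreover have "1 < sqrt (real N)" using N by simp
      ultimately have n2: "2 \<le> n" by linarith
      have "L = 2 * ln (sqrt (real N))" unfolding L_def using N by (simp add: ln_sqrt)
      also have "\<dots> \<le> 2 * ln (real n)"
        using sqrt_less \<open>1 < sqrt (real N)\<close> by (intro mult_left_mono ln_mono) linarith+
      finally have "L powr (2 + \<epsilon>) \<le> (2 * ln (real n)) powr (2 + \<epsilon>)"
        using L assms by (intro powr_mono2) auto
      also have "\<dots> = 2 powr (2 + \<epsilon>) * ln (real n) powr (2 + \<epsilon>)"
        by (rule powr_mult)
      finally have L_le: "90 * L powr (2 + \<epsilon>) \<le> C * ln (real n) powr (2 + \<epsilon>)"
        by (simp add: C_def)
      have "real (wl_steps G) \<le> 90 * ln (real N) powr (2 + \<epsilon>)" if "circulant_graph n G" for G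
        by (rule wl_steps_le_of_bounds[OF n2 nN(2) N that, where K = K])
           (use not_bad nN K(2) assms in \<open>auto simp: t_def L_def\<close>)
      then have "?Q n" using L_le unfolding L_def by (blast intro: order_trans)
      then show False using n by blast
    qed
    then have "card {n \<in> {1..N}. \<not> ?Q n} \<le> card (?A \<union> ?B \<union> ?S)"
      by (intro card_mono) auto
    also have "\<dots> \<le> card ?A + card ?B + card ?S"
      by (intro order_trans[OF card_Un_le] add_right_mono card_Un_le)
    finally have "real (card {n \<in> {1..N}. \<not> ?Q n}) \<le> real (card ?A) + real (card ?B) + real (card ?S)"
      by (simp only: of_nat_le_iff of_nat_add[symmetric])
    also have "\<dots> \<le> real N * ((1 + L) / t) + real N * ((L + 4)\<^sup>2 / 2 ^ Suc K) + real N * (1 / sqrt (real N))"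
    proof (intro add_mono)
      show "real (card ?A) \<le> real N * ((1 + L) / t)"
        unfolding L_def using N by (intro card_many_divisors_le t) auto
      show "real (card ?B) \<le> real N * ((L + 4)\<^sup>2 / 2 ^ Suc K)"
        unfolding L_def using N K(3) by (intro card_many_factors_le) auto
      have "real (card ?S) \<le> sqrt (real N)" by simp
      also have "\<dots> = real N * (1 / sqrt (real N))" using N by (simp add: real_div_sqrt)
      finally show "real (card ?S) \<le> real N * (1 / sqrt (real N))" .
    qed
    also have "\<dots> \<le> real N * ((1 + L) / t) + real N * ((L + 4)\<^sup>2 / 2 powr (L powr (\<epsilon> / 6)))
        + real N * (1 / sqrt (real N))"
    proof -
      have "2 powr (L powr (\<epsilon> / 6)) \<le> 2 powr real (Suc K)"
        using K(1) by (intro powr_mono) auto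
      also have "\<dots> = 2 ^ Suc K" by (rule powr_realpow) simp
      finally have "(L + 4)\<^sup>2 / 2 ^ Suc K \<le> (L + 4)\<^sup>2 / 2 powr (L powr (\<epsilon> / 6))"
        by (intro divide_left_mono) auto
      then show ?thesis by (intro add_mono mult_left_mono order_refl) auto
    qed
    also have "\<dots> = real N * ?g N"
      by (simp add: L_def t_def distrib_left)
    finally show ?thesis .
  qed
  have "almost_all ?Q"
  proof (rule almost_allI)
    show "eventually (\<lambda>N. real (card {n \<in> {1..N}. \<not> ?Q n}) \<le> real N * ?g N) sequentially"
      using eventually_ge_at_top[of 3] by eventually_elim (rule bound)
    show "?g \<longlonglongrightarrow> 0"
      using assms by (intro exceptional_density_tendsto) auto
  qed
  moreover have "C > 0" by (simp add: C_def)
  ultimately show ?thesis by blast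
qed

end
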